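(* Let $m\ge1$. The polynomials $\mathrm{cwe}(C(m))$, where $C$ ranges over equivalence classes of binary self-orthogonal linear codes (of any length $N$) containing the all-ones vector $\mathbf 1$ and of dimension at most $m+1$, form a basis of the space of parabolic invariants, i.e. of polynomials in $\mathbb{R}[x_v : v\in\mathbb{F}_2^{\,m}]$ invariant under the parabolic subgroup $P$.
   Context: Index the standard basis of $\mathbb{R}^{2^m}$ by $v\in\mathbb{F}_2^{\,m}$ and let $g\in GL(2^m,\mathbb{R})$ act on $\mathbb{R}[x_v:v\in\mathbb{F}_2^{\,m}]$ by linear substitution $(g\cdot p)(x)=p(g^{-1}x)$. The parabolic subgroup $P\le O(2^m,\mathbb{R})$ is the group generated by (1) the diagonal matrices $\mathrm{diag}((-1)^{q(v)+a})_{v}$ for all quadratic forms $q(v)=\sum_{i\le j}c_{ij}v_iv_j$ ($c_{ij}\in\mathbb{F}_2$) on $\mathbb{F}_2^{\,m}$ and $a\in\{0,1\}$, and (2) the permutation matrices $b_v\mapsto b_{g(v)}$ for $g\in AGL(m,2)$. Fix an $\mathbb{F}_2$-basis $a_1,\dots,a_m$ of $\mathbb{F}_{2^m}$ and identify $f=\sum\varepsilon_ia_i$ with $(\varepsilon_i)\in\mathbb{F}_2^{\,m}$ so that $x_f=x_v$. For a binary linear code $C\subseteq\mathbb{F}_2^N$, $C(m)=C\otimes_{\mathbb{F}_2}\mathbb{F}_{2^m}$ and $\mathrm{cwe}(C(m))=\sum_{c\in C(m)}\prod_fx_f^{a_f(c)}$, $a_f(c)$ the number of coordinates equal to $f$.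 Self-orthogonal means $C\subseteq C^\perp$ (standard dot product); two codes are equivalent if one is obtained from the other by a permutation of coordinates. *)

theory Defs
  imports
    "HOL-Analysis.Analysis"
    "HOL-Algebra.Generated_Groups"
    "HOL-Analysis.Finite_Function_Topology"
    "HOL-Library.Poly_Mapping"
    "HOL-Library.Function_Algebras"
    "HOL-Library.Z2"
begin

text \<open>
  The number \<open>m \<ge> 1\<close> is \<open>CARD('m)\<close>; the type \<^typ>\<open>bit\<close> is the field with two elements, so
  that \<open>bit ^ 'm\<close> is \<open>\<F>\<^sub>2\<^sup>m\<close>.
\<close>

instance bit :: finite
proof
  have "(UNIV :: bit set) = {0, 1}"
    using bit_not_zero_iff by auto
  then show "finite (UNIV :: bit set)"
    by (metis finite.emptyI finite.insertI)
qed


section \<open>Polynomials and linear substitutions\<close>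

text \<open>
  A polynomial maps monomials (exponent functions) to coefficients. Its ring structure is the
  convolution product of \<^theory>\<open>HOL-Library.Poly_Mapping\<close>, its real vector space structure the one
  of \<^theory>\<open>HOL-Analysis.Finite_Function_Topology\<close>.
\<close>

type_synonym 'v mpoly = "('v \<Rightarrow>\<^sub>0 nat) \<Rightarrow>\<^sub>0 real"

definition mconst :: "real \<Rightarrow> 'v mpoly" where
  "mconst r = Poly_Mapping.single 0 r"

definition mvar :: "'v \<Rightarrow> 'v mpoly" where
  "mvar v = Poly_Mapping.single (Poly_Mapping.single v 1) 1"

definition msubst :: "('v \<Rightarrow> 'w mpoly) \<Rightarrow> 'v mpoly \<Rightarrow> 'w mpoly" where
  "msubst \<sigma> p =
    (\<Sum>t\<in>Poly_Mapping.keys p. mconst (Poly_Mapping.lookup p t) *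
      (\<Prod>v\<in>Poly_Mapping.keys t. \<sigma> v ^ Poly_Mapping.lookup t v))"

text \<open>\<open>(g \<cdot> p)(x) = p (g\<^sup>-\<^sup>1 x)\<close>: the variable \<open>x\<^sub>v\<close> is replaced by the \<open>v\<close>-th entry of \<open>g\<^sup>-\<^sup>1 x\<close>.\<close>

definition mat_act :: "real ^ 'v ^ 'v \<Rightarrow> ('v::finite) mpoly \<Rightarrow> 'v mpoly" where
  "mat_act g = msubst (\<lambda>v. \<Sum>w\<in>UNIV. mconst (matrix_inv g $ v $ w) * mvar w)"


section \<open>The parabolic subgroup\<close>

definition orthogonal_group :: "(real ^ 'v ^ 'v) monoid" where
  "orthogonal_group = \<lparr>carrier = {A. orthogonal_matrix A}, monoid.mult = (**), one = mat 1\<rparr>"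

definition quadratic_form ::
    "('m \<Rightarrow> 'm \<Rightarrow> bit) \<Rightarrow> bit ^ ('m::{finite,linorder}) \<Rightarrow> bit" where
  "quadratic_form c v = (\<Sum>i\<in>UNIV. \<Sum>j\<in>{i..}. c i j * v $ i * v $ j)"

definition sign_matrix :: "(bit ^ 'm \<Rightarrow> bit) \<Rightarrow> real ^ (bit ^ 'm) ^ (bit ^ ('m::finite))" where
  "sign_matrix s = (\<chi> u v. if u = v then (if s v = 0 then 1 else - 1) else 0)"

definition affine_general_linear :: "(bit ^ 'm \<Rightarrow> bit ^ ('m::finite)) set" where
  "affine_general_linear = {\<lambda>v. A *v v + b | A b. invertible A}"

text \<open>The column of index \<open>v\<close> is the basis vector \<open>b\<^bsub>g v\<^esub>\<close>.\<close>

definition perm_matrix :: "('v \<Rightarrow> 'v) \<Rightarrow> real ^ 'v ^ ('v::finite)" where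
  "perm_matrix g = (\<chi> u v. if u = g v then 1 else 0)"

definition parabolic ::
    "(real ^ (bit ^ ('m::{finite,linorder})) ^ (bit ^ ('m::{finite,linorder}))) set" where
  "parabolic = generate orthogonal_group
    ({sign_matrix (\<lambda>v. quadratic_form c v + a) | c a. True} \<union> perm_matrix ` affine_general_linear)"

definition parabolic_invariants :: "(bit ^ ('m::{finite,linorder})) mpoly set" where
  "parabolic_invariants = {p. \<forall>g\<in>parabolic. mat_act g p = p}"


section \<open>Codes\<close>

text \<open>
  The vectors of length \<open>N\<close> over a field are represented by the functions on \<^typ>\<open>nat\<close> that vanish
  outside \<open>{..<N}\<close>.
\<close>

definition words :: "nat \<Rightarrow> (nat \<Rightarrow> 'a::zero) set" where
  "words N = {w. \<forall>i\<ge>N. w i = 0}"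

definition word_scale :: "'a::field \<Rightarrow> (nat \<Rightarrow> 'a) \<Rightarrow> nat \<Rightarrow> 'a" where
  "word_scale c w = (\<lambda>i. c * w i)"

interpretation word: vector_space word_scale
  by standard (auto simp: word_scale_def fun_eq_iff algebra_simps)

definition all_ones :: "nat \<Rightarrow> nat \<Rightarrow> bit" where
  "all_ones N = (\<lambda>i. if i < N then 1 else 0)"

definition linear_code :: "nat \<Rightarrow> (nat \<Rightarrow> bit) set \<Rightarrow> bool" where
  "linear_code N C \<longleftrightarrow> C \<subseteq> words N \<and> word.subspace C"

definition dual_code :: "nat \<Rightarrow> (nat \<Rightarrow> bit) set \<Rightarrow> (nat \<Rightarrow> bit) set" where
  "dual_code N C = {w \<in> words N. \<forall>u\<in>C. (\<Sum>i<N. u i * w i) = 0}"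

definition self_orthogonal :: "nat \<Rightarrow> (nat \<Rightarrow> bit) set \<Rightarrow> bool" where
  "self_orthogonal N C \<longleftrightarrow> C \<subseteq> dual_code N C"

text \<open>
  A code is paired with its length. The length \<open>0\<close> is allowed: its only code \<open>{0}\<close> has dimension
  \<open>0\<close> and contains the (empty) all-ones vector; its weight enumerator is the constant \<open>1\<close>.
\<close>

definition self_orthogonal_codes :: "nat \<Rightarrow> (nat \<times> (nat \<Rightarrow> bit) set) set" where
  "self_orthogonal_codes k =
    {(N, C). linear_code N C \<and> self_orthogonal N C \<and> all_ones N \<in> C \<and> word.dim C \<le> k}"

definition equivalent_codes ::
    "nat \<times> (nat \<Rightarrow> bit) set \<Rightarrow> nat \<times> (nat \<Rightarrow> bit) set \<Rightarrow> bool" where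
  "equivalent_codes = (\<lambda>(N, C) (N', C').
    N = N' \<and> (\<exists>\<pi>. \<pi> permutes {..<N} \<and> C' = (\<lambda>w. w \<circ> \<pi>) ` C))"


section \<open>Scalar extension and complete weight enumerators\<close>

text \<open>
  The map \<open>of_bit\<close> is the embedding of the prime field into a field of characteristic 2. The
  definitions below are meant for finite fields of cardinality \<open>2 ^ CARD('m)\<close>, where
  \<open>bit_scale\<close> is indeed a vector space structure.
\<close>

definition of_bit :: "bit \<Rightarrow> 'f::field" where
  "of_bit b = (if b = 0 then 0 else 1)"

definition bit_scale :: "bit \<Rightarrow> 'f::field \<Rightarrow> 'f" where
  "bit_scale b x = of_bit b * x"

definition bit_basis :: "('m \<Rightarrow> 'f::field) \<Rightarrow> bool" where
  "bit_basis a \<longleftrightarrow> inj a \<and> \<not> module.dependent bit_scale (range a)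
    \<and> module.span bit_scale (range a) = UNIV"

text \<open>The identification of \<open>f = \<Sum>i. \<epsilon> i * a i\<close> with \<open>\<epsilon>\<close>.\<close>

definition coordinates :: "('m \<Rightarrow> 'f::field) \<Rightarrow> 'f \<Rightarrow> bit ^ ('m::finite)" where
  "coordinates a f = (THE \<epsilon>. f = (\<Sum>i\<in>UNIV. bit_scale (\<epsilon> $ i) (a i)))"

text \<open>
  \<open>C \<otimes> \<F>\<close> inside \<open>\<F>\<^sup>N\<close>: the map \<open>c \<otimes> f \<mapsto> f * c\<close> identifies it with the \<open>\<F>\<close>-linear span of \<open>C\<close>.
\<close>

definition extend_code :: "(nat \<Rightarrow> bit) set \<Rightarrow> (nat \<Rightarrow> 'f::field) set" where
  "extend_code C = word.span ((\<lambda>c i. of_bit (c i)) ` C)"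

definition cwe_ext ::
    "('m \<Rightarrow> 'f::{field,finite}) \<Rightarrow> nat \<times> (nat \<Rightarrow> bit) set \<Rightarrow> (bit ^ ('m::finite)) mpoly" where
  "cwe_ext a = (\<lambda>(N, C).
    \<Sum>c\<in>extend_code C. \<Prod>f\<in>UNIV. mvar (coordinates a f) ^ card {i. i < N \<and> c i = f})"

end

theory Submission
  imports Defs
begin

text \<open>
  A monomial of degree \<open>N\<close> is the multiset of columns of an \<open>m \<times> N\<close> matrix over \<open>F\<^sub>2\<close>. The sign
  matrices fix it iff the code spanned by the rows and \<open>\<one>\<close> is self-orthogonal, and
  \<open>AGL(m, 2)\<close> acts on the matrices by affine row operations, so that its orbits are the
  equivalence classes of these codes, which have dimension at most \<open>m + 1\<close>. Hence the sums \<open>e D\<close>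
  of the monomials whose matrices generate \<open>D\<close> are a basis of the invariants. A word of
  \<open>C \<otimes> F\<close> is an \<open>m\<close>-tuple of words of \<open>C\<close>; sorting the tuples by the code that they
  generate gives \<open>cwe (C \<otimes> F) = (\<Sum>D\<subseteq>C. e D)\<close>, a system which is triangular with respect to
  inclusion.
\<close>

section \<open>Substitution homomorphisms\<close>

text \<open>The sign of a quadratic form on a monomial is the parity of the sum of the form over the
  columns, which expands into inner products of rows. The identity x * x = x in F_2 supplies the
  inner products with the all-ones word, and the constant term supplies the parity of N; together
  these are all the conditions of self-orthogonality. The bound m + 1 counts the m rows of a matrix
  and the all-ones word; conversely, a basis containing that word leaves at most m vectors to be
  used as rows.

  Two obstacles shape the argument. A monomial forgets the order of its columns, so a sum over
  monomials becomes a sum over matrices only after division by the number of matrices with that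
  monomial. And distinct subcodes of C can be equivalent, with equal sums \<open>e D\<close>;
  independence is therefore proved by comparing cardinalities of codes, since the system is
  triangular only up to equivalence.\<close>

lemma lookup_scaleR [simp]:
  "Poly_Mapping.lookup (r *\<^sub>R p) t = r * Poly_Mapping.lookup p t"
  for p :: "'v mpoly"
proof -
  have "finite {i. r *\<^sub>R Poly_Mapping.lookup p i \<noteq> 0}"
    by (rule finite_subset[OF _ finite_keys[of p]]) (auto simp: in_keys_iff)
  then show ?thesis
    by (simp add: scaleR_poly_mapping_def)
qed

lemma lookup_mconst_times:
  "Poly_Mapping.lookup (mconst r * p) t = r * Poly_Mapping.lookup p t"
  unfolding mconst_def
  by (cases "r = 0") (simp_all flip: mult_map_scale_conv_mult add: Poly_Mapping.map.rep_eq when_def)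

lemma mconst_times_eq_scaleR: "mconst r * p = r *\<^sub>R p"
  by (rule poly_mapping_eqI) (simp add: lookup_mconst_times)

lemma mconst_0 [simp]: "mconst 0 = 0"
  by (simp add: mconst_def)

lemma mconst_1 [simp]: "mconst 1 = 1"
  by (simp add: mconst_def)

lemma mconst_add: "mconst (r + s) = mconst r + mconst s"
  by (simp add: mconst_def single_add)

lemma mconst_mult: "mconst (r * s) = mconst r * mconst s"
  by (simp add: mconst_def mult_single)

lemma mconst_sum: "mconst (sum f A) = (\<Sum>x\<in>A. mconst (f x))"
  by (induction A rule: infinite_finite_induct) (auto simp: mconst_add)

lemma mpoly_eq_sum_single:
  "p = (\<Sum>t\<in>Poly_Mapping.keys p. Poly_Mapping.lookup p t *\<^sub>R Poly_Mapping.single t 1)"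
  for p :: "'v mpoly"
proof (rule poly_mapping_eqI)
  fix s
  show "Poly_Mapping.lookup p s = Poly_Mapping.lookup
     (\<Sum>t\<in>Poly_Mapping.keys p. Poly_Mapping.lookup p t *\<^sub>R Poly_Mapping.single t 1) s"
    by (simp add: lookup_sum lookup_single when_def in_keys_iff if_distrib[of "\<lambda>x. _ * x"] cong: if_cong)
qed

text \<open>Reduces identities that are linear in \<open>p\<close> to monomials. No freshness
  condition on \<open>t\<close> is imposed, so in the step case additivity and homogeneity
  suffice.\<close>

lemma mpoly_induct [case_names zero step]:
  fixes p :: "'v mpoly"
  assumes "P 0" and "\<And>r t p. P p \<Longrightarrow> P (mconst r * Poly_Mapping.single t 1 + p)"
  shows "P p"
proof -
  have "P (\<Sum>t\<in>T. Poly_Mapping.lookup p t *\<^sub>R Poly_Mapping.single t 1)" if "finite T" for T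
    using that by induction (auto simp: assms simp flip: mconst_times_eq_scaleR)
  then show ?thesis
    by (metis finite_keys mpoly_eq_sum_single)
qed

definition monom_subst :: "('v \<Rightarrow> 'w mpoly) \<Rightarrow> ('v \<Rightarrow>\<^sub>0 nat) \<Rightarrow> 'w mpoly" where
  "monom_subst \<sigma> t = (\<Prod>v\<in>Poly_Mapping.keys t. \<sigma> v ^ Poly_Mapping.lookup t v)"

lemma monom_subst_superset:
  assumes "finite A" "Poly_Mapping.keys t \<subseteq> A"
  shows "monom_subst \<sigma> t = (\<Prod>v\<in>A. \<sigma> v ^ Poly_Mapping.lookup t v)"
  unfolding monom_subst_def
  by (rule prod.mono_neutral_left) (use assms in \<open>auto simp: in_keys_iff\<close>)

lemma monom_subst_add: "monom_subst \<sigma> (s + t) = monom_subst \<sigma> s * monom_subst \<sigma> t"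
proof -
  let ?A = "Poly_Mapping.keys s \<union> Poly_Mapping.keys t"
  have "monom_subst \<sigma> u = (\<Prod>v\<in>?A. \<sigma> v ^ Poly_Mapping.lookup u v)" if "u \<in> {s, t, s + t}" for u
    using that keys_add[of s t] by (intro monom_subst_superset) auto
  then show ?thesis
    by (simp add: lookup_add power_add prod.distrib)
qed

lemma monom_subst_0 [simp]: "monom_subst \<sigma> 0 = 1"
  by (simp add: monom_subst_def)

lemma monom_subst_single [simp]: "monom_subst \<sigma> (Poly_Mapping.single v n) = \<sigma> v ^ n"
  by (cases "n = 0") (simp_all add: monom_subst_def)

lemma monom_subst_sum: "monom_subst \<sigma> (sum f A) = (\<Prod>x\<in>A. monom_subst \<sigma> (f x))"
  by (induction A rule: infinite_finite_induct) (auto simp: monom_subst_add)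

lemma msubst_superset:
  assumes "finite A" "Poly_Mapping.keys p \<subseteq> A"
  shows "msubst \<sigma> p = (\<Sum>t\<in>A. mconst (Poly_Mapping.lookup p t) * monom_subst \<sigma> t)"
  unfolding msubst_def monom_subst_def[symmetric]
  by (rule sum.mono_neutral_left) (use assms in \<open>auto simp: in_keys_iff\<close>)

lemma msubst_0 [simp]: "msubst \<sigma> 0 = 0"
  by (simp add: msubst_def)

lemma msubst_add: "msubst \<sigma> (p + q) = msubst \<sigma> p + msubst \<sigma> q"
proof -
  let ?A = "Poly_Mapping.keys p \<union> Poly_Mapping.keys q"
  have "msubst \<sigma> u = (\<Sum>t\<in>?A. mconst (Poly_Mapping.lookup u t) * monom_subst \<sigma> t)"
    if "u \<in> {p, q, p + q}" for u
    using that keys_add[of p q] by (intro msubst_superset) auto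
  then show ?thesis
    by (simp add: lookup_add mconst_add algebra_simps sum.distrib)
qed

lemma msubst_sum: "msubst \<sigma> (sum f A) = (\<Sum>x\<in>A. msubst \<sigma> (f x))"
  by (induction A rule: infinite_finite_induct) (auto simp: msubst_add)

lemma msubst_mconst_times: "msubst \<sigma> (mconst r * p) = mconst r * msubst \<sigma> p"
proof -
  have "Poly_Mapping.keys (mconst r * p) \<subseteq> Poly_Mapping.keys p"
    by (auto simp: in_keys_iff lookup_mconst_times)
  then have "msubst \<sigma> (mconst r * p)
      = (\<Sum>t\<in>Poly_Mapping.keys p. mconst r * (mconst (Poly_Mapping.lookup p t) * monom_subst \<sigma> t))"
    by (subst msubst_superset[OF finite_keys]) (auto simp: lookup_mconst_times mconst_mult mult.assoc)
  then show ?thesis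
    by (simp add: msubst_superset[OF finite_keys order_refl] sum_distrib_left)
qed

lemma msubst_single [simp]: "msubst \<sigma> (Poly_Mapping.single t 1) = monom_subst \<sigma> t"
  by (simp add: msubst_def monom_subst_def)

lemma msubst_1 [simp]: "msubst \<sigma> 1 = 1"
  by (metis msubst_single monom_subst_0 single_one)

lemma msubst_mvar [simp]: "msubst \<sigma> (mvar v) = \<sigma> v"
  by (simp add: mvar_def)

lemma msubst_mult: "msubst \<sigma> (p * q) = msubst \<sigma> p * msubst \<sigma> q"
proof (induction p rule: mpoly_induct)
  case (step r s p)
  have "msubst \<sigma> (Poly_Mapping.single s 1 * q) = monom_subst \<sigma> s * msubst \<sigma> q"
  proof (induction q rule: mpoly_induct)
    case (step r' t q)
    have "Poly_Mapping.single s 1 * (mconst r' * Poly_Mapping.single t 1 + q)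
        = mconst r' * Poly_Mapping.single (s + t) 1 + Poly_Mapping.single s 1 * q"
      by (simp add: algebra_simps mult_single mconst_def)
    then show ?case
      using step by (simp add: msubst_add msubst_mconst_times monom_subst_add algebra_simps)
  qed simp
  then show ?case
    using step by (simp add: distrib_right msubst_add msubst_mconst_times mult.assoc)
qed simp

lemma msubst_power: "msubst \<sigma> (p ^ n) = msubst \<sigma> p ^ n"
  by (induction n) (auto simp: msubst_mult)

lemma msubst_prod: "msubst \<sigma> (prod f A) = (\<Prod>x\<in>A. msubst \<sigma> (f x))"
  by (induction A rule: infinite_finite_induct) (auto simp: msubst_mult)

lemma msubst_msubst: "msubst \<sigma> (msubst \<tau> p) = msubst (\<lambda>v. msubst \<sigma> (\<tau> v)) p"
proof (induction p rule: mpoly_induct)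
  case (step r t p)
  have "msubst \<sigma> (monom_subst \<tau> t) = monom_subst (\<lambda>v. msubst \<sigma> (\<tau> v)) t"
    by (simp add: monom_subst_def msubst_prod msubst_power)
  then show ?case
    using step by (simp add: msubst_add msubst_mconst_times)
qed simp

lemma monom_subst_mvar: "monom_subst mvar t = Poly_Mapping.single t 1"
proof -
  have "(mvar v :: 'a mpoly) ^ n = Poly_Mapping.single (Poly_Mapping.single v n) 1" for v :: 'a and n
    by (induction n) (auto simp: mvar_def mult_single simp flip: single_add)
  moreover have "(\<Prod>v\<in>A. Poly_Mapping.single (f v) (1::real)) = Poly_Mapping.single (sum f A) 1"
    for A and f :: "'a \<Rightarrow> 'a \<Rightarrow>\<^sub>0 nat"
    by (induction A rule: infinite_finite_induct) (auto simp: mult_single)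
  moreover have "(\<Sum>v\<in>Poly_Mapping.keys t. Poly_Mapping.single v (Poly_Mapping.lookup t v)) = t"
    by (rule poly_mapping_eqI) (simp add: lookup_sum lookup_single when_def in_keys_iff)
  ultimately show ?thesis
    by (simp add: monom_subst_def)
qed

lemma msubst_mvar_id: "msubst mvar p = p"
  by (induction p rule: mpoly_induct) (auto simp: msubst_add msubst_mconst_times monom_subst_mvar)

section \<open>The action of orthogonal matrices on polynomials\<close>

lemma mat_act_add: "mat_act g (p + q) = mat_act g p + mat_act g q"
  and mat_act_scaleR: "mat_act g (r *\<^sub>R p) = r *\<^sub>R mat_act g p"
  and mat_act_sum: "mat_act g (sum f A) = (\<Sum>x\<in>A. mat_act g (f x))"
  by (simp_all add: mat_act_def msubst_add msubst_sum msubst_mconst_times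
        flip: mconst_times_eq_scaleR)

lemma matrix_inv_eqI:
  "A ** B = mat 1 \<Longrightarrow> B ** A = mat 1 \<Longrightarrow> matrix_inv A = B"
  for A B :: "real ^ 'n ^ 'n"
  by (metis (mono_tags, lifting) matrix_inv_def matrix_mul_assoc matrix_mul_lid matrix_mul_rid someI)

lemma mat_act_one: "mat_act (mat 1) p = p"
  for p :: "('v::finite) mpoly"
proof -
  have "(\<lambda>v. \<Sum>w\<in>UNIV. mconst (matrix_inv (mat 1 :: real ^ 'v ^ 'v) $ v $ w) * mvar w) = mvar"
  proof -
    have "matrix_inv (mat 1 :: real ^ 'v ^ 'v) = mat 1"
      by (rule matrix_inv_eqI) simp_all
    then show ?thesis
      by (simp add: mat_def if_distrib[of mconst] if_distrib[of "\<lambda>x. x * _"] cong: if_cong)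
  qed
  then show ?thesis
    by (simp add: mat_act_def msubst_mvar_id)
qed

lemma matrix_inv_orthogonal:
  "orthogonal_matrix A \<Longrightarrow> matrix_inv A = transpose A"
  for A :: "real ^ 'n ^ 'n"
  by (rule matrix_inv_eqI) (auto simp: orthogonal_matrix_def)

text \<open>Composing substitutions reverses the order of the matrices, and so does inverting a
  product; the two reversals cancel and leave a left action.\<close>

lemma mat_act_mult:
  assumes "orthogonal_matrix g" "orthogonal_matrix h"
  shows "mat_act (g ** h) p = mat_act g (mat_act h p)"
proof -
  have inv: "matrix_inv (g ** h) = matrix_inv h ** matrix_inv g"
    using assms by (simp add: matrix_inv_orthogonal orthogonal_matrix_mul matrix_transpose_mul)
  have "(\<Sum>u\<in>UNIV. mconst (matrix_inv (g ** h) $ v $ u) * mvar u) =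
     (\<Sum>w\<in>UNIV. mconst (matrix_inv h $ v $ w) * (\<Sum>u\<in>UNIV. mconst (matrix_inv g $ w $ u) * mvar u))" for v
    unfolding inv
    by (simp add: matrix_matrix_mult_def[of "matrix_inv h"] mconst_sum mconst_mult sum_distrib_left sum_distrib_right mult.assoc)
      (rule sum.swap)
  then show ?thesis
    by (simp add: mat_act_def msubst_msubst msubst_sum msubst_mconst_times)
qed


section \<open>Matrices with the same affine row space\<close>

interpretation vec_word: vector_space_pair "(*s) :: 'a::field \<Rightarrow> 'a ^ 'n \<Rightarrow> 'a ^ 'n" word_scale ..

text \<open>The lift is \<open>T'\<close> followed by a linear right inverse of \<open>T\<close> on
  its range.\<close>

lemma linear_lift:
  fixes T T' :: "'a::field ^ 'n \<Rightarrow> nat \<Rightarrow> 'a"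
  assumes "Vector_Spaces.linear (*s) word_scale T" "Vector_Spaces.linear (*s) word_scale T'"
    and "range T' \<subseteq> range T"
  obtains R where "Vector_Spaces.linear (*s) (*s) R" "\<And>x. T (R x) = T' x"
proof -
  obtain g where g: "Vector_Spaces.linear word_scale (*s) g" "\<forall>v\<in>range T. T (g v) = v"
    using vec_word.linear_exists_right_inverse_on[OF assms(1) vec.subspace_UNIV] by blast
  have "Vector_Spaces.linear (*s) (*s) (g \<circ> T')"
    by (rule Vector_Spaces.linear_compose[OF assms(2) g(1)])
  then show ?thesis
    by (rule that) (use g(2) assms(3) in \<open>metis comp_apply rangeI subsetD\<close>)
qed

lemma projection_exists:
  fixes K :: "('a::field ^ 'n) set"
  assumes "vec.subspace K"
  obtains P where "Vector_Spaces.linear (*s) (*s) P" "range P \<subseteq> K" "\<And>x. x \<in> K \<Longrightarrow> P x = x"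
  using vec.linear_exists_left_inverse_on[OF vec.linear_id assms] by auto

lemma kernel_dim_le:
  fixes T T' :: "'a::field ^ 'n \<Rightarrow> nat \<Rightarrow> 'a"
  assumes T: "Vector_Spaces.linear (*s) word_scale T" and T': "Vector_Spaces.linear (*s) word_scale T'"
    and "range T' \<subseteq> range T"
  shows "vec.dim {x. T x = 0} \<le> vec.dim {x. T' x = 0}"
proof -
  interpret T: Vector_Spaces.linear "(*s)" word_scale T by fact
  interpret T': Vector_Spaces.linear "(*s)" word_scale T' by fact
  let ?K = "{x. T x = 0}" and ?K' = "{x. T' x = 0}"
  obtain R where R: "Vector_Spaces.linear (*s) (*s) R" "\<And>x. T (R x) = T' x"
    using linear_lift[OF assms] by blast
  interpret R: Vector_Spaces.linear "(*s)" "(*s)" R by fact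
  obtain P where P: "Vector_Spaces.linear (*s) (*s) P" "range P \<subseteq> ?K'" "\<And>x. x \<in> ?K' \<Longrightarrow> P x = x"
    using projection_exists[OF T'.subspace_kernel] by blast
  interpret P: Vector_Spaces.linear "(*s)" "(*s)" P by fact
  define W where "W = {x. P x = 0}"
  have W: "vec.subspace W"
    unfolding W_def by (rule P.subspace_kernel)
  have W_kernel: "x = 0" if "x \<in> W" "T' x = 0" for x
    using that P(3) by (auto simp: W_def)
  have "inj_on R W"
    unfolding R.inj_on_iff_eq_0[OF W] using W_kernel R(2) T.zero by metis
  then have dim_RW: "vec.dim (R ` W) = vec.dim W"
    using W by (intro vec.dim_image_eq R(1)) (simp add: vec.span_eq_iff[THEN iffD2])
  have "vec.dim {x + y |x y. x \<in> ?K' \<and> y \<in> W} + vec.dim (?K' \<inter> W) = vec.dim ?K' + vec.dim W"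
    by (rule vec.dim_sums_Int[OF T'.subspace_kernel W])
  moreover have "{x + y |x y. x \<in> ?K' \<and> y \<in> W} = UNIV"
  proof -
    have "x = P x + (x - P x)" "P x \<in> ?K'" "x - P x \<in> W" for x
    proof -
      show "x = P x + (x - P x)" by simp
      show Px: "P x \<in> ?K'" using P(2) by blast
      show "x - P x \<in> W" using P(3)[OF Px] by (simp add: W_def P.diff)
    qed
    then show ?thesis by blast
  qed
  moreover have "?K' \<inter> W = {0}"
    using W_kernel vec.subspace_0[OF W] T'.zero by auto
  ultimately have *: "vec.dim ?K' + vec.dim W = vec.dim (UNIV :: ('a ^ 'n) set)"
    by (simp only: vec.dim_eq_0[THEN iffD2, OF subset_refl] add_0_right)
  have "vec.dim {x + y |x y. x \<in> ?K \<and> y \<in> R ` W} + vec.dim (?K \<inter> R ` W) = vec.dim ?K + vec.dim (R ` W)"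
    by (rule vec.dim_sums_Int[OF T.subspace_kernel R.subspace_image[OF W]])
  moreover have "?K \<inter> R ` W = {0}"
  proof -
    have "R x = 0" if "x \<in> W" "T (R x) = 0" for x
      using W_kernel[of x] that R(2) R.zero by auto
    then show ?thesis
      using vec.subspace_0[OF R.subspace_image[OF W]] T.zero by auto
  qed
  moreover have "vec.dim {x + y |x y. x \<in> ?K \<and> y \<in> R ` W} \<le> vec.dim (UNIV :: ('a ^ 'n) set)"
    by (rule vec.dim_subset) simp
  ultimately show ?thesis
    using * dim_RW by simp
qed

text \<open>Applied to \<open>row_combination\<close>, whose range is the row space, this turns an
  equality of row spaces into an invertible change of coefficients.\<close>

lemma linear_same_range:
  fixes T T' :: "'a::field ^ 'n \<Rightarrow> nat \<Rightarrow> 'a"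
  assumes T: "Vector_Spaces.linear (*s) word_scale T" and T': "Vector_Spaces.linear (*s) word_scale T'"
    and range: "range T' = range T"
  obtains A :: "'a ^ 'n ^ 'n" where "invertible A" "\<And>x. T (A *v x) = T' x"
proof -
  interpret T: Vector_Spaces.linear "(*s)" word_scale T by fact
  interpret T': Vector_Spaces.linear "(*s)" word_scale T' by fact
  let ?K = "{x. T x = 0}" and ?K' = "{x. T' x = 0}"
  obtain R where R: "Vector_Spaces.linear (*s) (*s) R" "\<And>x. T (R x) = T' x"
    using linear_lift[OF T T'] range by blast
  obtain P where P: "Vector_Spaces.linear (*s) (*s) P" "range P \<subseteq> ?K'" "\<And>x. x \<in> ?K' \<Longrightarrow> P x = x"
    using projection_exists[OF T'.subspace_kernel] by blast
  have "vec.dim ?K' = vec.dim ?K"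
    using kernel_dim_le[OF T T'] kernel_dim_le[OF T' T] range by simp
  then obtain \<phi> where \<phi>: "Vector_Spaces.linear (*s) (*s) \<phi>" "\<phi> ` ?K' = ?K" "inj_on \<phi> ?K'"
    using vec.subspace_isomorphism[OF T'.subspace_kernel T.subspace_kernel] by blast
  txt \<open>The lift \<open>R\<close> need not be injective; on the kernel of \<open>T'\<close> it can be replaced by \<open>\<phi>\<close>.\<close>
  define g where "g x = \<phi> (P x) + R (x - P x)" for x
  interpret R: Vector_Spaces.linear "(*s)" "(*s)" R by fact
  interpret P: Vector_Spaces.linear "(*s)" "(*s)" P by fact
  interpret \<phi>: Vector_Spaces.linear "(*s)" "(*s)" \<phi> by fact
  have g: "Vector_Spaces.linear (*s) (*s) g"
    by unfold_locales
      (simp_all add: g_def P.add \<phi>.add R.add R.diff P.scale \<phi>.scale R.scale algebra_simps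
        vec.scale_right_distrib vec.scale_right_diff_distrib)
  have Tg: "T (g x) = T' x" for x
  proof -
    have "\<phi> (P x) \<in> ?K" "P x \<in> ?K'"
      using P(2) \<phi>(2) by blast+
    then show ?thesis
      by (simp add: g_def T.add R(2) T'.diff)
  qed
  interpret g: Vector_Spaces.linear "(*s)" "(*s)" g by fact
  have "inj g"
  proof -
    have "x = 0" if "g x = 0" for x
    proof -
      have x: "x \<in> ?K'"
        using Tg[of x] that T.zero by simp
      then have "\<phi> x = 0"
        using that P(3) by (simp add: g_def R.zero)
      then show "x = 0"
        using \<phi>(3) x \<phi>.zero T'.zero by (metis (mono_tags) inj_onD mem_Collect_eq)
    qed
    then show ?thesis
      using g.inj_iff_eq_0 by blast
  qed
  then have "bij g"
    using vec.linear_inj_imp_surj[OF g] by (simp add: bij_def)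
  moreover have "matrix g *v x = g x" for x
    by (rule matrix_works[OF g])
  ultimately show ?thesis
    using that[of "matrix g"] Tg by (simp add: invertible_eq_bij bij_def inj_def surj_def)
qed

section \<open>Matrices given by their columns, and their affine row spaces\<close>

definition code_row :: "(nat \<Rightarrow> 'a ^ 'm) \<Rightarrow> 'm \<Rightarrow> nat \<Rightarrow> 'a" where
  "code_row c i = (\<lambda>k. c k $ i)"

definition row_combination :: "(nat \<Rightarrow> 'a::field ^ 'm) \<Rightarrow> 'a ^ 'm \<Rightarrow> nat \<Rightarrow> 'a" where
  "row_combination c x = (\<lambda>k. \<Sum>i\<in>UNIV. x $ i * c k $ i)"

text \<open>For \<open>c\<close> in \<open>words N\<close>, the elements are the evaluations of all
  affine functions on F_2^m at the columns \<open>c k\<close>; this is why affine maps of the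
  columns are the relevant symmetries.\<close>

definition column_code :: "nat \<Rightarrow> (nat \<Rightarrow> bit ^ 'm) \<Rightarrow> (nat \<Rightarrow> bit) set" where
  "column_code N c = word.span (insert (all_ones N) (range (code_row c)))"

lemma linear_row_combination: "Vector_Spaces.linear (*s) word_scale (row_combination c)"
  by unfold_locales
    (auto simp: row_combination_def word_scale_def fun_eq_iff algebra_simps sum.distrib sum_distrib_left)

lemma word_sum_apply: "(\<Sum>x\<in>A. f x) k = (\<Sum>x\<in>A. f x k)" for f :: "'b \<Rightarrow> nat \<Rightarrow> 'a::field"
  by (induction A rule: infinite_finite_induct) auto

lemma span_row: "word.span (range (code_row c)) = range (row_combination c)"
  for c :: "nat \<Rightarrow> 'a::field ^ 'm::finite"
proof (rule word.span_unique)
  interpret L: Vector_Spaces.linear "(*s)" word_scale "row_combination c"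
    by (rule linear_row_combination)
  show "word.subspace (range (row_combination c))"
    by (rule L.subspace_image[OF vec.subspace_UNIV])
  show "range (code_row c) \<subseteq> range (row_combination c)"
  proof
    fix w assume "w \<in> range (code_row c)"
    then obtain i where "w = code_row c i" by blast
    then have "w = row_combination c (axis i 1)"
      by (simp add: code_row_def row_combination_def axis_def if_distrib[of "\<lambda>x. x * _"] cong: if_cong)
    then show "w \<in> range (row_combination c)" by blast
  qed
  fix S assume S: "range (code_row c) \<subseteq> S" "word.subspace S"
  have "row_combination c x = (\<Sum>i\<in>UNIV. word_scale (x $ i) (code_row c i))" for x
    by (simp add: fun_eq_iff row_combination_def code_row_def word_scale_def word_sum_apply)
  then show "range (row_combination c) \<subseteq> S"
    using S by (auto intro!: word.subspace_sum word.subspace_scale)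
qed

lemma mem_column_code_iff:
  "w \<in> column_code N c \<longleftrightarrow> (\<exists>\<alpha> x. w = word_scale \<alpha> (all_ones N) + row_combination c x)"
  unfolding column_code_def word.span_insert span_row by (force simp: algebra_simps)

lemma transpose_works:
  "(\<Sum>i\<in>UNIV. (A *v x) $ i * y $ i) = (\<Sum>i\<in>UNIV. x $ i * (transpose A *v y) $ i)"
  for A :: "'a::field ^ 'n ^ 'm"
  by (simp add: matrix_vector_mult_def transpose_def sum_distrib_left sum_distrib_right mult_ac)
    (rule sum.swap)

lemma sum_axis_times: "(\<Sum>i\<in>UNIV. axis j 1 $ i * y $ i) = y $ j"
  for y :: "'a::field ^ 'n"
  by (simp add: axis_def if_distrib[of "\<lambda>x. x * _"] cong: if_cong)

text \<open>After normalization, the two row spaces give an invertible matrix that acts on the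
  coefficient vectors of row combinations. Its transpose acts on the columns, and comparing the two
  first columns gives the translation.\<close>

lemma affine_equivalent_if_same_code:
  fixes c c' :: "nat \<Rightarrow> bit ^ 'm"
  assumes same: "column_code N c = column_code N c'"
    and c: "c \<in> words N" and c': "c' \<in> words N"
  obtains g where "g \<in> affine_general_linear" "\<And>k. k < N \<Longrightarrow> c' k = g (c k)"
proof (cases "N = 0")
  case True
  have "(\<lambda>v. mat 1 *v v + 0) \<in> (affine_general_linear :: (bit ^ 'm \<Rightarrow> bit ^ 'm) set)"
    unfolding affine_general_linear_def invertible_def using matrix_mul_lid by blast
  then show ?thesis
    using that True by blast
next
  case False
  txt \<open>Translating the first column to 0 leaves the words of the code that vanish at 0, which
    removes the all-ones word and reduces the claim to linear maps.\<close>
  define normal where "normal c k = (if k < N then c k - c 0 else 0)" for c :: "nat \<Rightarrow> bit ^ 'm" and k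
  have range: "range (row_combination (normal c)) = {w \<in> column_code N c. w 0 = 0}"
    if "c \<in> words N" for c
  proof -
    \<comment> \<open>Subtracting the first column from all columns changes a row combination by its
      value at 0 times the all-ones word.\<close>
    have eq: "row_combination (normal c) x
        = word_scale (- row_combination c x 0) (all_ones N) + row_combination c x" for x
    proof
      fix k
      show "row_combination (normal c) x k
        = (word_scale (- row_combination c x 0) (all_ones N) + row_combination c x) k"
      proof (cases "k < N")
        case True
        then show ?thesis
          by (simp only: row_combination_def normal_def word_scale_def all_ones_def if_True plus_fun_apply
              vector_minus_component right_diff_distrib sum_subtractf mult_1_right uminus_add_conv_diff)
      next
        case False
        then have "c k = 0" using that by (simp add: words_def)
        with False show ?thesis
          by (simp add: row_combination_def normal_def word_scale_def all_ones_def)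
      qed
    qed
    show ?thesis
    proof (intro equalityI subsetI)
      fix w assume "w \<in> range (row_combination (normal c))"
      then obtain x where w: "w = row_combination (normal c) x" by blast
      have "w \<in> column_code N c"
        unfolding mem_column_code_iff w eq by blast
      moreover have "w 0 = 0"
        unfolding w by (simp add: row_combination_def normal_def)
      ultimately show "w \<in> {w \<in> column_code N c. w 0 = 0}" by blast
    next
      fix w assume "w \<in> {w \<in> column_code N c. w 0 = 0}"
      then obtain \<alpha> x where w: "w = word_scale \<alpha> (all_ones N) + row_combination c x" "w 0 = 0"
        by (auto simp: mem_column_code_iff)
      \<comment> \<open>Since \<open>N\<close> is positive, the all-ones word is 1 at position 0, so
        \<open>w 0 = 0\<close> determines \<alpha>.\<close>
      then have "\<alpha> = - row_combination c x 0"
        using False by (cases \<alpha>; cases "row_combination c x 0") (simp_all add: word_scale_def all_ones_def)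
      then have "w = row_combination (normal c) x"
        unfolding eq using w(1) by blast
      then show "w \<in> range (row_combination (normal c))"
        by blast
    qed
  qed
  have "range (row_combination (normal c')) = range (row_combination (normal c))"
    using range[OF c] range[OF c'] same by simp
  then obtain A :: "bit ^ 'm ^ 'm" where A: "invertible A"
    "\<And>x. row_combination (normal c) (A *v x) = row_combination (normal c') x"
    using linear_same_range[OF linear_row_combination linear_row_combination] by metis
  have normal: "normal c' k = transpose A *v normal c k" for k
  proof -
    have "(\<Sum>i\<in>UNIV. x $ i * normal c' k $ i) = (\<Sum>i\<in>UNIV. x $ i * (transpose A *v normal c k) $ i)" for x
      using fun_cong[OF A(2)[of x], of k] unfolding transpose_works[symmetric]
      by (simp add: row_combination_def)
    from this[of "axis _ 1"] show ?thesis
      unfolding vec_eq_iff sum_axis_times by blast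
  qed
  have "c' k = transpose A *v c k + (c' 0 - transpose A *v c 0)" if "k < N" for k
    using normal[of k] that by (simp add: normal_def matrix_vector_mult_diff_distrib algebra_simps)
  moreover have "(\<lambda>v. transpose A *v v + (c' 0 - transpose A *v c 0)) \<in> affine_general_linear"
  proof -
    obtain B where "A ** B = mat 1" "B ** A = mat 1"
      using A(1) by (auto simp: invertible_def)
    then have "invertible (transpose A)"
      unfolding invertible_def by (metis matrix_transpose_mul transpose_mat)
    then show ?thesis
      unfolding affine_general_linear_def by blast
  qed
  ultimately show ?thesis
    using that by blast
qed


section \<open>The action of the parabolic subgroup on monomials\<close>

definition mon :: "nat \<Rightarrow> (nat \<Rightarrow> 'v) \<Rightarrow> 'v \<Rightarrow>\<^sub>0 nat" where
  "mon N c = (\<Sum>k<N. Poly_Mapping.single (c k) 1)"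

lemma mon_cong: "(\<And>k. k < N \<Longrightarrow> c k = c' k) \<Longrightarrow> mon N c = mon N c'"
  by (simp add: mon_def)

lemma lookup_mon: "Poly_Mapping.lookup (mon N c) v = card {k. k < N \<and> c k = v}"
proof -
  have "Poly_Mapping.lookup (mon N c) v = (\<Sum>k<N. if c k = v then 1 else 0)"
    by (simp add: mon_def lookup_sum lookup_single when_def del: One_nat_def)
  also have "\<dots> = card ({..<N} \<inter> {k. c k = v})"
    by (simp add: sum.If_cases del: One_nat_def)
  also have "{..<N} \<inter> {k. c k = v} = {k. k < N \<and> c k = v}"
    by auto
  finally show ?thesis .
qed

lemma sum_lookup_mon: "(\<Sum>v\<in>UNIV. Poly_Mapping.lookup (mon N c) v) = N"
  for c :: "nat \<Rightarrow> 'v::finite"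
  by (simp add: mon_def lookup_sum lookup_single when_def sum.swap[of _ "{..<N}"])

lemma mon_eq_length: "mon N c = mon N' c' \<Longrightarrow> N = N'"
  for c c' :: "nat \<Rightarrow> 'v::finite"
  by (metis sum_lookup_mon)

lemma lookup_mon_map: "Poly_Mapping.lookup (mon N c) v = count (mset (map c [0..<N])) v"
  unfolding lookup_mon count_mset count_list_eq_length_filter length_filter_conv_card
  by (rule arg_cong[where f = card]) auto

lemma mon_exhaust:
  fixes t :: "'v::{finite,zero} \<Rightarrow>\<^sub>0 nat"
  obtains N c where "c \<in> words N" "t = mon N c"
proof -
  obtain xs where xs: "mset xs = (\<Sum>v\<in>UNIV. replicate_mset (Poly_Mapping.lookup t v) v)"
    using ex_mset by blast
  define c where "c k = (if k < length xs then xs ! k else 0)" for k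
  have "map c [0..<length xs] = xs"
    by (rule nth_equalityI) (auto simp: c_def)
  then have "t = mon (length xs) c"
    by (intro poly_mapping_eqI) (simp add: lookup_mon_map xs count_sum)
  then show ?thesis
    using that[of c "length xs"] by (auto simp: words_def c_def)
qed

text \<open>The source of code equivalence: a monomial determines its matrix up to the order of the
  columns. Beyond \<open>N\<close> the permutation is the identity and both matrices vanish, so the
  equation holds on all of \<open>nat\<close>.\<close>

lemma mon_eq_imp_permutes:
  assumes "mon N c = mon N c'" "c \<in> words N" "c' \<in> words N"
  obtains \<pi> where "\<pi> permutes {..<N}" "c = c' \<circ> \<pi>"
proof -
  have "mset (map c [0..<N]) = mset (map c' [0..<N])"
    by (rule multiset_eqI) (metis assms(1) lookup_mon_map)
  then obtain \<pi> where \<pi>: "\<pi> permutes {..<length (map c' [0..<N])}"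
    "permute_list \<pi> (map c' [0..<N]) = map c [0..<N]"
    by (rule mset_eq_permutation)
  have "c k = c' (\<pi> k)" for k
  proof (cases "k < N")
    case True
    then have "\<pi> k < N"
      using permutes_in_image[OF \<pi>(1), of k] by simp
    moreover have "map c [0..<N] ! k = map c' [0..<N] ! \<pi> k"
      using permute_list_nth[OF \<pi>(1), of k] True \<pi>(2) by simp
    ultimately show ?thesis using True by simp
  next
    case False
    then have "\<pi> k = k"
      using permutes_not_in[OF \<pi>(1), of k] by simp
    then show ?thesis using False assms(2,3) by (simp add: words_def)
  qed
  then show ?thesis
    using that[of \<pi>] \<pi>(1) by (auto simp: fun_eq_iff)
qed

lemma mon_comp_permutes:
  assumes "\<pi> permutes {..<N}"
  shows "mon N (c \<circ> \<pi>) = mon N c"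
  unfolding mon_def using sum.permute[OF assms, of "\<lambda>k. Poly_Mapping.single (c k) 1", symmetric]
  by (simp only: comp_def)

lemma prod_mvar: "(\<Prod>k<N. mvar (c k)) = Poly_Mapping.single (mon N c) 1"
  unfolding mon_def by (induction N) (auto simp: mvar_def mult_single add.commute)

lemma monom_subst_mon: "monom_subst \<sigma> (mon N c) = (\<Prod>k<N. \<sigma> (c k))"
  unfolding mon_def monom_subst_sum monom_subst_single power_one_right ..

section \<open>The generators of the parabolic subgroup and the group they generate\<close>

lemma orthogonal_matrix_perm_matrix:
  assumes "bij g"
  shows "orthogonal_matrix (perm_matrix g)"
  unfolding orthogonal_matrix
proof (simp add: vec_eq_iff, intro allI)
  fix u w
  have "(transpose (perm_matrix g) ** perm_matrix g) $ u $ w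
      = (\<Sum>x\<in>UNIV. if x = g u then if g u = g w then 1 else 0 else 0)"
    unfolding matrix_matrix_mult_def transpose_def perm_matrix_def
    by (simp only: vec_lambda_beta, intro sum.cong) auto
  then show "(transpose (perm_matrix g) ** perm_matrix g) $ u $ w = mat 1 $ u $ w"
    using bij_is_inj[OF assms] by (simp add: mat_def inj_eq)
qed

lemma orthogonal_matrix_sign_matrix: "orthogonal_matrix (sign_matrix s)"
  unfolding orthogonal_matrix
proof (simp add: vec_eq_iff, intro allI)
  fix u w
  have "(transpose (sign_matrix s) ** sign_matrix s) $ u $ w
      = (\<Sum>x\<in>UNIV. if x = u then if u = w then 1 else 0 else 0)"
    unfolding matrix_matrix_mult_def transpose_def sign_matrix_def
    by (simp only: vec_lambda_beta, intro sum.cong) auto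
  then show "(transpose (sign_matrix s) ** sign_matrix s) $ u $ w = mat 1 $ u $ w"
    by (simp add: mat_def)
qed

text \<open>The inverse is the transpose, whose row \<open>v\<close> has its 1 in column
  \<open>g v\<close>; hence the variable of \<open>v\<close> is replaced by that of
  \<open>g v\<close>.\<close>

lemma mat_act_perm_matrix:
  assumes "bij g"
  shows "mat_act (perm_matrix g) (Poly_Mapping.single (mon N c) 1)
    = Poly_Mapping.single (mon N (g \<circ> c)) 1"
proof -
  have "(\<Sum>w\<in>UNIV. mconst (matrix_inv (perm_matrix g) $ v $ w) * mvar w)
      = (\<Sum>w\<in>UNIV. if w = g v then mvar w else 0)" for v
    unfolding matrix_inv_orthogonal[OF orthogonal_matrix_perm_matrix[OF assms]]
    by (intro sum.cong) (auto simp: transpose_def perm_matrix_def)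
  then have "mat_act (perm_matrix g) = msubst (\<lambda>v. mvar (g v))"
    by (simp add: mat_act_def)
  then show ?thesis
    by (simp add: monom_subst_mon prod_mvar[of "g \<circ> c", unfolded comp_def] comp_def)
qed

lemma bit_sign_add:
  "(if x + y = (0::bit) then 1 else - 1 :: real) = (if x = 0 then 1 else - 1) * (if y = 0 then 1 else - 1)"
  by (cases x; cases y) simp_all

lemma mat_act_sign_matrix:
  "mat_act (sign_matrix s) (Poly_Mapping.single (mon N c) 1)
    = (if (\<Sum>k<N. s (c k)) = 0 then 1 else - 1) *\<^sub>R Poly_Mapping.single (mon N c) 1"
proof -
  define e where "e v = (if s v = 0 then 1 else - 1 :: real)" for v
  have "(\<Sum>w\<in>UNIV. mconst (matrix_inv (sign_matrix s) $ v $ w) * mvar w)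
      = (\<Sum>w\<in>UNIV. if w = v then mconst (e v) * mvar w else 0)" for v
    unfolding matrix_inv_orthogonal[OF orthogonal_matrix_sign_matrix]
    by (intro sum.cong) (auto simp: transpose_def sign_matrix_def e_def)
  then have "mat_act (sign_matrix s) = msubst (\<lambda>v. mconst (e v) * mvar v)"
    by (simp add: mat_act_def)
  moreover have "(\<Prod>k<N. mconst (e (c k)) * mvar (c k)) = mconst (\<Prod>k<N. e (c k)) * (\<Prod>k<N. mvar (c k))"
    by (induction N) (auto simp: mconst_mult)
  moreover have "(\<Prod>k<N. e (c k)) = (if (\<Sum>k<N. s (c k)) = 0 then 1 else - 1)"
  proof (induction N)
    case (Suc N)
    then show ?case by (simp only: prod.lessThan_Suc sum.lessThan_Suc bit_sign_add e_def)
  qed simp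
  ultimately show ?thesis
    by (simp only: msubst_single monom_subst_mon prod_mvar mconst_times_eq_scaleR)
qed

lemma group_orthogonal_group: "group (orthogonal_group :: (real ^ 'n ^ 'n) monoid)"
proof (rule groupI)
  fix A :: "real ^ 'n ^ 'n" assume "A \<in> carrier orthogonal_group"
  then show "\<exists>B\<in>carrier orthogonal_group. B \<otimes>\<^bsub>orthogonal_group\<^esub> A = \<one>\<^bsub>orthogonal_group\<^esub>"
    by (auto simp: orthogonal_group_def orthogonal_matrix_def intro!: exI[of _ "transpose A"])
qed (auto simp: orthogonal_group_def orthogonal_matrix_mul orthogonal_matrix_id matrix_mul_assoc)

lemma inv_orthogonal_group:
  "orthogonal_matrix A \<Longrightarrow> inv\<^bsub>orthogonal_group\<^esub> A = transpose A"
  by (rule group.inv_equality[OF group_orthogonal_group])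
    (auto simp: orthogonal_group_def orthogonal_matrix_def)

lemma bij_affine_general_linear:
  assumes "g \<in> affine_general_linear"
  shows "bij g"
proof -
  obtain A b where g: "g = (\<lambda>v. A *v v + b)" and A: "invertible A"
    using assms by (auto simp: affine_general_linear_def)
  have "bij ((\<lambda>v. v + b) \<circ> (\<lambda>v. A *v v))"
    using A by (intro bij_comp) (auto simp: invertible_eq_bij bij_plus_right)
  then show ?thesis by (simp add: g comp_def)
qed

text \<open>Orthogonality is carried through the induction because \<open>mat_act_mult\<close>
  requires it. An inverse fixes \<open>p\<close> since it can be applied to both sides of the
  equation for \<open>h\<close>.\<close>

lemma generate_invariant:
  assumes S: "\<And>h. h \<in> S \<Longrightarrow> orthogonal_matrix h" "\<And>h. h \<in> S \<Longrightarrow> mat_act h p = p"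
    and "g \<in> generate orthogonal_group S"
  shows "orthogonal_matrix g \<and> mat_act g p = p"
  using assms(3)
proof induction
  case one
  then show ?case by (simp add: orthogonal_group_def orthogonal_matrix_id mat_act_one)
next
  case (incl h)
  then show ?case using S by simp
next
  case (inv h)
  then have h: "orthogonal_matrix h" "mat_act h p = p" using S by auto
  have t: "orthogonal_matrix (transpose h)"
    using h(1) by (simp add: orthogonal_matrix_transpose)
  have "mat_act (transpose h) p = mat_act (transpose h ** h) p"
    by (simp only: mat_act_mult[OF t h(1)] h(2))
  also have "\<dots> = p"
    using h(1) by (simp add: orthogonal_matrix mat_act_one)
  finally show ?case
    using t by (simp add: inv_orthogonal_group[OF h(1)])
next
  case (eng h1 h2)
  then show ?case by (simp add: orthogonal_group_def orthogonal_matrix_mul mat_act_mult)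
qed

lemma parabolic_invariants_iff:
  "p \<in> parabolic_invariants \<longleftrightarrow>
    (\<forall>c a. mat_act (sign_matrix (\<lambda>v. quadratic_form c v + a)) p = p)
    \<and> (\<forall>g\<in>affine_general_linear. mat_act (perm_matrix g) p = p)"
  for p :: "(bit ^ ('m::{finite,linorder})) mpoly"
proof
  assume "p \<in> parabolic_invariants"
  then show "(\<forall>c a. mat_act (sign_matrix (\<lambda>v. quadratic_form c v + a)) p = p)
      \<and> (\<forall>g\<in>affine_general_linear. mat_act (perm_matrix g) p = p)"
    unfolding parabolic_invariants_def parabolic_def by (blast intro: generate.incl)
next
  assume p: "(\<forall>c a. mat_act (sign_matrix (\<lambda>v. quadratic_form c v + a)) p = p)
      \<and> (\<forall>g\<in>affine_general_linear. mat_act (perm_matrix g) p = p)"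
  have "mat_act g p = p" if "g \<in> parabolic" for g
    using that unfolding parabolic_def
  proof (rule generate_invariant[THEN conjunct2, rotated 2])
    fix h :: "real ^ (bit ^ ('m::{finite,linorder})) ^ (bit ^ ('m::{finite,linorder}))"
    assume "h \<in> {sign_matrix (\<lambda>v. quadratic_form c v + a) | c a. True} \<union> perm_matrix ` affine_general_linear"
    then show "orthogonal_matrix h" "mat_act h p = p"
      using p orthogonal_matrix_sign_matrix orthogonal_matrix_perm_matrix bij_affine_general_linear
      by blast+
  qed
  then show "p \<in> parabolic_invariants"
    by (simp add: parabolic_invariants_def)
qed


section \<open>Complete weight enumerators as sums over tuples of codewords\<close>

lemma finite_words [simp]: "finite (words N :: (nat \<Rightarrow> 'a::{finite,zero}) set)"
proof -
  have "words N = {f :: nat \<Rightarrow> 'a. \<forall>k. (k \<in> {..<N} \<longrightarrow> f k \<in> UNIV) \<and> (k \<notin> {..<N} \<longrightarrow> f k = 0)}"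
    by (auto simp: words_def)
  then show ?thesis
    using finite_set_of_finite_funs[of "{..<N}" "UNIV :: 'a set" 0] by simp
qed

text \<open>An \<open>m\<close>-tuple of codewords is stored as the matrix with these words as rows.
  The same object then lists, by its columns, the variables of a monomial.\<close>

definition tuples :: "(nat \<Rightarrow> bit) set \<Rightarrow> (nat \<Rightarrow> bit ^ 'm) set" where
  "tuples C = {c. \<forall>i. code_row c i \<in> C}"

lemma tuples_subset_words: "C \<subseteq> words N \<Longrightarrow> tuples C \<subseteq> words N"
  by (auto simp: tuples_def words_def code_row_def vec_eq_iff subset_iff)

lemma finite_tuples: "C \<subseteq> words N \<Longrightarrow> finite (tuples C :: (nat \<Rightarrow> bit ^ 'm::finite) set)"
  using finite_subset[OF tuples_subset_words finite_words] by blast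

section \<open>The extension field as a vector space over F_2, and the extended code\<close>

definition basis_combination :: "('m \<Rightarrow> 'f::field) \<Rightarrow> bit ^ 'm::finite \<Rightarrow> 'f" where
  "basis_combination a \<epsilon> = (\<Sum>i\<in>UNIV. bit_scale (\<epsilon> $ i) (a i))"

text \<open>Translation by 1 permutes the field, so the sum of all elements equals itself plus the
  image of the cardinality. Thus the power \<open>2 ^ n\<close> vanishes in the field, and so does
  2.\<close>

lemma two_eq_0:
  assumes "CARD('f::{field,finite}) = 2 ^ n"
  shows "(1 + 1 :: 'f) = 0"
proof -
  have "(\<Sum>x\<in>(UNIV :: 'f set). x + 1) = (\<Sum>x\<in>(UNIV :: 'f set). x)"
    by (rule sum.reindex_bij_betw[OF bij_plus_right])
  then have "of_nat (CARD('f)) = (0 :: 'f)"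
    by (simp add: sum.distrib)
  then show ?thesis
    unfolding assms by simp
qed

lemma vector_space_bit_scale:
  assumes "CARD('f::{field,finite}) = 2 ^ n"
  shows "vector_space (bit_scale :: bit \<Rightarrow> 'f \<Rightarrow> 'f)"
proof
  fix x y :: bit and u v :: 'f
  have "u + u = 0"
    using two_eq_0[OF assms] by (metis mult_2 mult_zero_left one_add_one)
  then show "bit_scale (x + y) u = bit_scale x u + bit_scale y u"
    by (cases x; cases y) (simp_all add: bit_scale_def of_bit_def)
qed (simp_all add: bit_scale_def of_bit_def distrib_left)

text \<open>Spanning gives surjectivity; the domain and the codomain have the same finite
  cardinality.\<close>

lemma bij_basis_combination:
  fixes a :: "'m::finite \<Rightarrow> 'f::{field,finite}"
  assumes card: "CARD('f) = 2 ^ CARD('m)" and a: "bit_basis a"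
  shows "bij (basis_combination a)"
proof -
  interpret V: vector_space "bit_scale :: bit \<Rightarrow> 'f \<Rightarrow> 'f"
    by (rule vector_space_bit_scale[OF card])
  have "surj (basis_combination a)"
  proof
    show "UNIV \<subseteq> range (basis_combination a)"
    proof
      fix f
      have "f \<in> V.span (range a)"
        using a by (simp add: bit_basis_def)
      then obtain u where "f = (\<Sum>v\<in>range a. bit_scale (u v) v)"
        by (auto simp: V.span_finite)
      also have "\<dots> = (\<Sum>i\<in>UNIV. bit_scale (u (a i)) (a i))"
        using a by (simp add: bit_basis_def sum.reindex)
      also have "\<dots> = basis_combination a (\<chi> i. u (a i))"
        by (simp add: basis_combination_def)
      finally show "f \<in> range (basis_combination a)"
        by blast
    qed
  qed simp
  moreover have "CARD(bit ^ 'm) = CARD('f)"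
  proof -
    have "(UNIV :: bit set) = {0, 1}"
      using bit_not_zero_iff by auto
    then have "CARD(bit) = card {0, 1 :: bit}"
      by simp
    then show ?thesis
      using card by (simp add: numeral_2_eq_2)
  qed
  ultimately show ?thesis
    by (intro bijI eq_card_imp_inj_on) simp_all
qed

lemma coordinates_basis_combination:
  assumes "bij (basis_combination a)"
  shows "coordinates a (basis_combination a \<epsilon>) = \<epsilon>"
  unfolding coordinates_def basis_combination_def[symmetric]
  by (rule the_equality) (use bij_is_inj[OF assms] in \<open>auto simp: inj_eq\<close>)

text \<open>If the scalars are written in the basis \<open>a\<close>, a combination of words of
  \<open>C\<close> over the large field has as its \<open>i\<close>-th coordinate word a combination
  over F_2, which stays in \<open>C\<close>.\<close>

lemma extend_code_eq:
  fixes a :: "'m::finite \<Rightarrow> 'f::{field,finite}"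
  assumes card: "CARD('f) = 2 ^ CARD('m)" and a: "bit_basis a" and C: "word.subspace C"
  shows "extend_code C = (\<lambda>c k. basis_combination a (c k)) ` tuples C"
proof
  interpret V: vector_space "bit_scale :: bit \<Rightarrow> 'f \<Rightarrow> 'f"
    by (rule vector_space_bit_scale[OF card])
  have bij: "bij (basis_combination a)"
    by (rule bij_basis_combination[OF card a])
  show "extend_code C \<subseteq> (\<lambda>c k. basis_combination a (c k)) ` tuples C"
  proof
    fix w :: "nat \<Rightarrow> 'f" assume "w \<in> extend_code C"
    then show "w \<in> (\<lambda>c k. basis_combination a (c k)) ` tuples C"
      unfolding extend_code_def
    proof (induction rule: word.span_induct_alt)
      case base
      have "(\<lambda>k. 0) \<in> (tuples C :: (nat \<Rightarrow> bit ^ 'm) set)"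
        using word.subspace_0[OF C] by (simp add: tuples_def code_row_def zero_fun_def)
      then show ?case
        by (rule rev_image_eqI) (simp add: basis_combination_def fun_eq_iff bit_scale_def of_bit_def)
    next
      case (step f x y)
      obtain u where u: "u \<in> C" "x = (\<lambda>k. of_bit (u k))"
        using step(1) by blast
      obtain c where c: "c \<in> tuples C" "y = (\<lambda>k. basis_combination a (c k))"
        using step(2) by blast
      obtain \<epsilon> where \<epsilon>: "f = basis_combination a \<epsilon>"
        using bij by (metis bij_is_surj surjD)
      \<comment> \<open>Adding the multiple of \<open>u\<close> by the scalar with coordinates
        \<epsilon> adds \<open>\<epsilon> $ i\<close> times \<open>u\<close> to row
        \<open>i\<close>.\<close>
      let ?c = "\<lambda>k. u k *s \<epsilon> + c k"
      have "code_row ?c i = word_scale (\<epsilon> $ i) u + code_row c i" for i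
      proof
        fix k
        show "code_row ?c i k = (word_scale (\<epsilon> $ i) u + code_row c i) k"
          by (cases "u k") (simp_all add: code_row_def word_scale_def)
      qed
      moreover have "word_scale (\<epsilon> $ i) u + code_row c i \<in> C" for i
        using c(1) u(1) by (intro word.subspace_add[OF C] word.subspace_scale[OF C]) (auto simp: tuples_def)
      ultimately have "?c \<in> tuples C"
        by (simp only: tuples_def mem_Collect_eq simp_thms)
      moreover have "word_scale f x + y = (\<lambda>k. basis_combination a (?c k))"
      proof
        fix k
        have "of_bit (u k) * basis_combination a \<epsilon> = basis_combination a (u k *s \<epsilon>)"
          by (cases "u k") (simp_all add: basis_combination_def of_bit_def bit_scale_def)
        then show "(word_scale f x + y) k = basis_combination a (?c k)"
          unfolding u(2) c(2) \<epsilon>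
          by (simp only: word_scale_def plus_fun_apply mult.commute[of "basis_combination a \<epsilon>"])
            (simp only: basis_combination_def V.scale_left_distrib sum.distrib vector_add_component)
      qed
      ultimately show ?case
        by (intro image_eqI[where x = ?c]) (simp_all only:)
    qed
  qed
  show "(\<lambda>c k. basis_combination a (c k)) ` tuples C \<subseteq> extend_code C"
  proof
    fix w assume "w \<in> (\<lambda>c k. basis_combination a (c k)) ` tuples C"
    then obtain c where c: "c \<in> tuples C" "w = (\<lambda>k. basis_combination a (c k))"
      by blast
    have "w = (\<Sum>i\<in>UNIV. word_scale (a i) (\<lambda>k. of_bit (code_row c i k)))"
    proof
      fix k
      show "w k = (\<Sum>i\<in>UNIV. word_scale (a i) (\<lambda>k. of_bit (code_row c i k))) k"
        unfolding c(2) basis_combination_def word_sum_apply word_scale_def code_row_def bit_scale_def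
        by (intro sum.cong refl mult.commute)
    qed
    moreover have "(\<lambda>k. of_bit (code_row c i k) :: 'f) \<in> (\<lambda>c k. of_bit (c k)) ` C" for i
      using c(1) by (auto simp: tuples_def)
    ultimately show "w \<in> extend_code C"
      unfolding extend_code_def
      by (simp add: word.span_sum word.span_scale word.span_base)
  qed
qed

text \<open>The complete weight enumerator freed of the field and of its basis: codewords over the
  extension are replaced by tuples of binary words.\<close>

definition tuple_enumerator :: "nat \<times> (nat \<Rightarrow> bit) set \<Rightarrow> (bit ^ 'm::finite) mpoly" where
  "tuple_enumerator = (\<lambda>(N, C). \<Sum>c\<in>tuples C. Poly_Mapping.single (mon N c) 1)"

lemma cwe_ext_eq_tuple_enumerator:
  fixes a :: "'m::finite \<Rightarrow> 'f::{field,finite}"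
  assumes card: "CARD('f) = 2 ^ CARD('m)" and a: "bit_basis a" and C: "linear_code N C"
  shows "cwe_ext a (N, C) = tuple_enumerator (N, C)"
proof -
  let ?\<phi> = "basis_combination a"
  have bij: "bij ?\<phi>"
    by (rule bij_basis_combination[OF card a])
  have "inj_on (\<lambda>c k. ?\<phi> (c k)) (tuples C)"
  proof (rule inj_onI)
    fix c c' :: "nat \<Rightarrow> bit ^ 'm"
    assume "(\<lambda>k. ?\<phi> (c k)) = (\<lambda>k. ?\<phi> (c' k))"
    then have "?\<phi> (c k) = ?\<phi> (c' k)" for k
      by (rule fun_cong)
    then show "c = c'"
      using bij_is_inj[OF bij] by (intro ext) (blast dest: injD)
  qed
  moreover have "(\<Prod>f\<in>UNIV. mvar (coordinates a f) ^ card {i. i < N \<and> ?\<phi> (c i) = f})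
      = Poly_Mapping.single (mon N c) 1" for c
  proof -
    have "(\<Prod>f\<in>UNIV. mvar (coordinates a f) ^ card {i. i < N \<and> ?\<phi> (c i) = f})
        = (\<Prod>v\<in>UNIV. mvar (coordinates a (?\<phi> v)) ^ card {i. i < N \<and> ?\<phi> (c i) = ?\<phi> v})"
      by (rule prod.reindex_bij_betw[OF bij, symmetric])
    also have "\<dots> = (\<Prod>v\<in>UNIV. mvar v ^ Poly_Mapping.lookup (mon N c) v)"
      by (simp only: coordinates_basis_combination[OF bij] inj_eq[OF bij_is_inj[OF bij]] lookup_mon)
    also have "\<dots> = Poly_Mapping.single (mon N c) 1"
      unfolding monom_subst_mvar[symmetric] by (rule monom_subst_superset[symmetric]) auto
    finally show ?thesis .
  qed
  ultimately show ?thesis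
    using C unfolding cwe_ext_def tuple_enumerator_def linear_code_def
    by (simp only: prod.case extend_code_eq[OF card a] sum.reindex comp_def)
qed


section \<open>Codes generated by tuples\<close>

lemma all_ones_in_column_code: "all_ones N \<in> column_code N c"
  unfolding column_code_def by (intro word.span_base) simp

lemma subspace_column_code: "word.subspace (column_code N c)"
  unfolding column_code_def by (rule word.subspace_span)

lemma tuples_column_code: "c \<in> tuples (column_code N c)"
  unfolding tuples_def column_code_def by (auto intro: word.span_base)

lemma column_code_subset:
  assumes "word.subspace C" "all_ones N \<in> C" "c \<in> tuples C"
  shows "column_code N c \<subseteq> C"
  unfolding column_code_def
  by (rule word.span_minimal) (use assms in \<open>auto simp: tuples_def\<close>)

lemma subspace_words: "word.subspace (words N)"
  by (auto simp: word.subspace_def words_def word_scale_def)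

lemma tuples_words: "tuples (words N) = words N"
  by (auto simp: tuples_def words_def code_row_def vec_eq_iff)

lemma all_ones_in_words: "all_ones N \<in> words N"
  by (simp add: words_def all_ones_def)

lemma column_code_subset_words:
  "c \<in> words N \<Longrightarrow> column_code N c \<subseteq> words N"
  by (rule column_code_subset) (simp_all add: subspace_words all_ones_in_words tuples_words)

lemma dim_column_code_le: "word.dim (column_code N c) \<le> CARD('m) + 1"
  for c :: "nat \<Rightarrow> bit ^ 'm::finite"
proof -
  have "word.dim (column_code N c) \<le> card (insert (all_ones N) (range (code_row c)))"
    unfolding column_code_def by (rule word.dim_le_card) auto
  also have "\<dots> \<le> Suc (card (range (code_row c)))"
    by (simp add: card_insert_if)
  also have "\<dots> \<le> Suc CARD('m)"
    by (simp add: card_image_le)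
  finally show ?thesis by simp
qed

section \<open>Self-orthogonality and generating tuples\<close>

lemma subspace_dual_code: "word.subspace (dual_code N C)"
  unfolding dual_code_def word.subspace_def
proof (intro conjI ballI allI)
  show "0 \<in> {w \<in> words N. \<forall>u\<in>C. (\<Sum>i<N. u i * w i) = 0}"
    by (simp add: words_def)
next
  fix x y assume "x \<in> {w \<in> words N. \<forall>u\<in>C. (\<Sum>i<N. u i * w i) = 0}"
    "y \<in> {w \<in> words N. \<forall>u\<in>C. (\<Sum>i<N. u i * w i) = 0}"
  then have xy: "x \<in> words N" "y \<in> words N"
    "\<And>u. u \<in> C \<Longrightarrow> (\<Sum>i<N. u i * x i) = 0" "\<And>u. u \<in> C \<Longrightarrow> (\<Sum>i<N. u i * y i) = 0"
    by (simp_all only: mem_Collect_eq)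
  have "(\<Sum>i<N. u i * (x + y) i) = (\<Sum>i<N. u i * x i) + (\<Sum>i<N. u i * y i)" for u
    by (simp only: plus_fun_apply distrib_left sum.distrib)
  then show "x + y \<in> {w \<in> words N. \<forall>u\<in>C. (\<Sum>i<N. u i * w i) = 0}"
    using xy by (simp only: mem_Collect_eq word.subspace_add[OF subspace_words]) (metis add_0)
next
  fix b x assume "x \<in> {w \<in> words N. \<forall>u\<in>C. (\<Sum>i<N. u i * w i) = 0}"
  then have x: "x \<in> words N" "\<And>u. u \<in> C \<Longrightarrow> (\<Sum>i<N. u i * x i) = 0"
    by (simp_all only: mem_Collect_eq)
  have "(\<Sum>i<N. u i * word_scale b x i) = b * (\<Sum>i<N. u i * x i)" for u
    by (simp only: word_scale_def sum_distrib_left mult.left_commute)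
  then show "word_scale b x \<in> {w \<in> words N. \<forall>u\<in>C. (\<Sum>i<N. u i * w i) = 0}"
    using x by (simp only: mem_Collect_eq word.subspace_scale[OF subspace_words]) (metis mult_zero_right)
qed

text \<open>Bilinearity is used one argument at a time: a dual code is a subspace, so orthogonality
  extends from generators to their span; the symmetry of the dot product then exchanges the two
  arguments.\<close>

lemma self_orthogonal_span:
  assumes "G \<subseteq> dual_code N G"
  shows "self_orthogonal N (word.span G)"
proof -
  have 1: "word.span G \<subseteq> dual_code N G"
    by (rule word.span_minimal[OF assms subspace_dual_code])
  have "G \<subseteq> dual_code N (word.span G)"
  proof
    fix g assume g: "g \<in> G"
    have "(\<Sum>i<N. u i * g i) = 0" if "u \<in> word.span G" for u
    proof -
      have "(\<Sum>i<N. g i * u i) = 0"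
        using 1 that g unfolding dual_code_def by blast
      then show ?thesis by (simp only: mult.commute)
    qed
    then show "g \<in> dual_code N (word.span G)"
      using g assms unfolding dual_code_def by blast
  qed
  then show ?thesis
    unfolding self_orthogonal_def by (rule word.span_minimal[OF _ subspace_dual_code])
qed

lemma self_orthogonal_codesD:
  assumes "(N, C) \<in> self_orthogonal_codes k"
  shows "C \<subseteq> words N" "word.subspace C" "all_ones N \<in> C" "word.dim C \<le> k"
    "\<And>u w. u \<in> C \<Longrightarrow> w \<in> C \<Longrightarrow> (\<Sum>i<N. u i * w i) = 0"
  using assms unfolding self_orthogonal_codes_def linear_code_def self_orthogonal_def dual_code_def
  by blast+

lemma column_code_in_self_orthogonal_codes:
  fixes c :: "nat \<Rightarrow> bit ^ 'm::finite"
  assumes C: "(N, C) \<in> self_orthogonal_codes k" and c: "c \<in> tuples C"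
  shows "(N, column_code N c) \<in> self_orthogonal_codes (CARD('m) + 1)"
proof -
  note C' = self_orthogonal_codesD[OF C]
  have sub: "column_code N c \<subseteq> C"
    by (rule column_code_subset[OF C'(2,3) c])
  have "column_code N c \<subseteq> dual_code N (column_code N c)"
    unfolding dual_code_def using sub C'(1,5) by blast
  then show ?thesis
    unfolding self_orthogonal_codes_def linear_code_def self_orthogonal_def
    using sub C'(1) dim_column_code_le[of N c] subspace_column_code[of N c] all_ones_in_column_code[of N c]
    by blast
qed

text \<open>As \<open>column_code\<close> always adjoins the all-ones word, a basis of
  \<open>C\<close> that contains this word leaves at most \<open>m\<close> vectors. They are placed
  injectively in the rows, and the remaining rows are set to 0.\<close>

lemma exists_generating_tuple:
  assumes C: "(N, C) \<in> self_orthogonal_codes (CARD('m::finite) + 1)"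
  obtains c :: "nat \<Rightarrow> bit ^ 'm" where "c \<in> tuples C" "column_code N c = C"
proof -
  note C' = self_orthogonal_codesD[OF C]
  have generators: "\<exists>c :: nat \<Rightarrow> bit ^ 'm. c \<in> tuples C \<and> column_code N c = C"
    if B: "B \<subseteq> C" "C \<subseteq> word.span (insert (all_ones N) B)" "card B \<le> CARD('m)" "finite B" for B
  proof -
    obtain h :: "(nat \<Rightarrow> bit) \<Rightarrow> 'm" where h: "inj_on h B"
      using card_le_inj[OF B(4), of "UNIV :: 'm set"] B(3) by auto
    define r where "r i = (if i \<in> h ` B then inv_into B h i else 0)" for i
    define c :: "nat \<Rightarrow> bit ^ 'm" where "c k = (\<chi> i. r i k)" for k
    have row: "code_row c = r"
      by (simp add: fun_eq_iff code_row_def c_def)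
    have "r i \<in> C" for i
      using B(1) word.subspace_0[OF C'(2)] by (auto simp: r_def inv_into_into subset_iff)
    then have c: "c \<in> tuples C"
      by (simp add: tuples_def row)
    have "b = r (h b)" if "b \<in> B" for b
      using h that by (simp add: r_def)
    then have "B \<subseteq> range (code_row c)"
      unfolding row by blast
    then have "C \<subseteq> column_code N c"
      unfolding column_code_def
      using B(2) word.span_mono[of "insert (all_ones N) B" "insert (all_ones N) (range (code_row c))"]
      by blast
    then show ?thesis
      using c column_code_subset[OF C'(2,3) c] by blast
  qed
  show ?thesis
  proof (cases "N = 0")
    \<comment> \<open>At length 0 the all-ones word is the zero vector and cannot belong to a basis,
      but then no generators are needed.\<close>
    case True
    then have "C \<subseteq> {0}"
      using C'(1) by (auto simp: words_def fun_eq_iff)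
    then have "C \<subseteq> word.span (insert (all_ones N) {})"
      using word.subspace_0[OF word.subspace_span] by blast
    then show ?thesis
      using generators[of "{}"] that by auto
  next
    case False
    have "word.independent {all_ones N}"
      using False by (simp add: word.dependent_single all_ones_def fun_eq_iff) blast
    then obtain B where B: "{all_ones N} \<subseteq> B" "B \<subseteq> C" "word.independent B" "C \<subseteq> word.span B"
      using word.maximal_independent_subset_extend[of "{all_ones N}" C] C'(3) by blast
    have fin: "finite B"
      using B(2) C'(1) finite_subset[OF _ finite_words] by blast
    have "card B \<le> CARD('m) + 1"
      using word.basis_card_eq_dim[OF B(2,4,3)] C'(4) by simp
    then have "card (B - {all_ones N}) \<le> CARD('m)"
      using B(1) fin by simp
    moreover have "insert (all_ones N) (B - {all_ones N}) = B"
      using B(1) by blast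
    ultimately show ?thesis
      using generators[of "B - {all_ones N}"] B(2,4) fin that by auto
  qed
qed

section \<open>Permutations of coordinates and affine maps of columns\<close>

lemma column_code_comp_permutes:
  assumes "\<pi> permutes {..<N}"
  shows "column_code N (c \<circ> \<pi>) = (\<lambda>w. w \<circ> \<pi>) ` column_code N c"
proof -
  have "all_ones N (\<pi> k) = all_ones N k" for k
    using permutes_in_image[OF assms, of k] by (simp add: all_ones_def)
  then have "word_scale \<alpha> (all_ones N) + row_combination (c \<circ> \<pi>) x
      = (word_scale \<alpha> (all_ones N) + row_combination c x) \<circ> \<pi>" for \<alpha> x
    by (simp only: fun_eq_iff word_scale_def row_combination_def comp_def plus_fun_apply) simp
  then show ?thesis
    by (fastforce simp: mem_column_code_iff)
qed

lemma tuples_comp: "tuples ((\<lambda>w. w \<circ> \<pi>) ` C) = (\<lambda>c. c \<circ> \<pi>) ` tuples C" if "bij \<pi>"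
proof (intro equalityI subsetI)
  fix d :: "nat \<Rightarrow> bit ^ 'm" assume d: "d \<in> tuples ((\<lambda>w. w \<circ> \<pi>) ` C)"
  have "code_row (d \<circ> inv_into UNIV \<pi>) i \<in> C" for i
  proof -
    obtain w where w: "w \<in> C" "code_row d i = w \<circ> \<pi>"
      using d by (auto simp: tuples_def)
    have "code_row (d \<circ> inv_into UNIV \<pi>) i = code_row d i \<circ> inv_into UNIV \<pi>"
      by (simp add: code_row_def comp_def)
    also have "\<dots> = w"
      using that by (simp add: w(2) fun_eq_iff bij_is_surj surj_f_inv_f)
    finally show ?thesis using w(1) by simp
  qed
  then have "d \<circ> inv_into UNIV \<pi> \<in> tuples C"
    by (simp add: tuples_def)
  moreover have "d = (d \<circ> inv_into UNIV \<pi>) \<circ> \<pi>"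
    using that by (simp add: fun_eq_iff bij_is_inj)
  ultimately show "d \<in> (\<lambda>c. c \<circ> \<pi>) ` tuples C"
    by blast
qed (auto simp: tuples_def code_row_def comp_def)

lemma tuple_enumerator_equivalent:
  assumes "equivalent_codes C D"
  shows "tuple_enumerator C = (tuple_enumerator D :: (bit ^ 'm::finite) mpoly)"
proof -
  obtain N C' D' \<pi> where *: "C = (N, C')" "D = (N, D')" "\<pi> permutes {..<N}" "D' = (\<lambda>w. w \<circ> \<pi>) ` C'"
    using assms by (auto simp: equivalent_codes_def split: prod.splits)
  have "inj_on (\<lambda>c. c \<circ> \<pi>) (tuples C' :: (nat \<Rightarrow> bit ^ 'm) set)"
    using permutes_surj[OF *(3)] by (auto simp: inj_on_def fun_eq_iff) (metis surjD)
  then show ?thesis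
    using *(3) by (simp add: *(1,2,4) tuple_enumerator_def tuples_comp permutes_bij sum.reindex mon_comp_permutes)
qed

text \<open>An affine map may move 0, so plain composition with \<open>g\<close> could leave
  \<open>words N\<close>; hence the truncation at \<open>N\<close>.\<close>

definition map_columns :: "nat \<Rightarrow> ('v \<Rightarrow> 'v::zero) \<Rightarrow> (nat \<Rightarrow> 'v) \<Rightarrow> nat \<Rightarrow> 'v" where
  "map_columns N g c = (\<lambda>k. if k < N then g (c k) else 0)"

lemma map_columns_in_words: "map_columns N g c \<in> words N"
  by (simp add: map_columns_def words_def)

lemma mon_map_columns: "mon N (map_columns N g c) = mon N (g \<circ> c)"
  by (rule mon_cong) (simp add: map_columns_def)

lemma inj_on_map_columns: "inj g \<Longrightarrow> inj_on (map_columns N g) (words N)"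
  by (rule inj_onI, rule ext)
    (metis (mono_tags, lifting) injD linorder_not_le map_columns_def mem_Collect_eq words_def)

text \<open>A row of the transformed matrix is a linear combination of the old rows plus a multiple
  of the all-ones word. The translation part is the reason why codes must contain that word.\<close>

lemma map_columns_tuples:
  assumes "g \<in> affine_general_linear" "word.subspace C" "all_ones N \<in> C" "C \<subseteq> words N" "c \<in> tuples C"
  shows "map_columns N g c \<in> tuples C"
proof -
  obtain A b where g: "g = (\<lambda>v. A *v v + b)"
    using assms(1) by (auto simp: affine_general_linear_def)
  have "code_row (map_columns N g c) i
      = (\<Sum>j\<in>UNIV. word_scale (A $ i $ j) (code_row c j)) + word_scale (b $ i) (all_ones N)" for i
  proof
    fix k
    show "code_row (map_columns N g c) i k
      = ((\<Sum>j\<in>UNIV. word_scale (A $ i $ j) (code_row c j)) + word_scale (b $ i) (all_ones N)) k"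
    proof (cases "k < N")
      case True
      then show ?thesis
        by (simp only: code_row_def map_columns_def g plus_fun_apply word_sum_apply word_scale_def
            all_ones_def if_True vector_add_component matrix_vector_mult_def vec_lambda_beta mult_1_right)
    next
      case False
      moreover have "c k = 0"
        using False tuples_subset_words[OF assms(4)] assms(5) by (auto simp: words_def)
      ultimately show ?thesis
        by (simp add: code_row_def map_columns_def word_sum_apply word_scale_def all_ones_def)
    qed
  qed
  then show ?thesis
    using assms by (auto simp: tuples_def intro!: word.subspace_add word.subspace_sum word.subspace_scale)
qed


section \<open>Invariants\<close>

lemma lookup_mat_act:
  "Poly_Mapping.lookup (mat_act g p) s = (\<Sum>t\<in>Poly_Mapping.keys p.
    Poly_Mapping.lookup p t * Poly_Mapping.lookup (mat_act g (Poly_Mapping.single t 1)) s)"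
proof -
  have "mat_act g p = mat_act g
      (\<Sum>t\<in>Poly_Mapping.keys p. Poly_Mapping.lookup p t *\<^sub>R Poly_Mapping.single t 1)"
    by (rule arg_cong[OF mpoly_eq_sum_single])
  then show ?thesis
    by (simp only: mat_act_sum mat_act_scaleR lookup_sum lookup_scaleR)
qed

text \<open>Each monomial is an eigenvector of a sign matrix with eigenvalue 1 or -1. In a fixed
  polynomial only the monomials with eigenvalue 1 can occur.\<close>

lemma sign_condition:
  fixes p :: "(bit ^ 'm::finite) mpoly"
  assumes p: "mat_act (sign_matrix s) p = p" and c: "Poly_Mapping.lookup p (mon N c) \<noteq> 0"
  shows "(\<Sum>k<N. s (c k)) = 0"
proof -
  define \<epsilon> where "\<epsilon> = (if (\<Sum>k<N. s (c k)) = 0 then 1 else - 1 :: real)"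
  have "Poly_Mapping.lookup p t * Poly_Mapping.lookup (mat_act (sign_matrix s) (Poly_Mapping.single t 1)) (mon N c)
      = (if t = mon N c then \<epsilon> * Poly_Mapping.lookup p t else 0)" for t
  proof (cases "t = mon N c")
    case True
    then show ?thesis by (simp add: mat_act_sign_matrix \<epsilon>_def)
  next
    case False
    obtain N' c' where "t = mon N' c'"
      by (rule mon_exhaust)
    with False show ?thesis by (simp add: mat_act_sign_matrix lookup_single)
  qed
  then have "Poly_Mapping.lookup (mat_act (sign_matrix s) p) (mon N c) = \<epsilon> * Poly_Mapping.lookup p (mon N c)"
    using c by (subst lookup_mat_act) (simp add: in_keys_iff)
  then have "\<epsilon> = 1"
    using p c by simp
  then show ?thesis
    unfolding \<epsilon>_def by (simp split: if_splits)
qed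

lemma mon_comp_eq_iff:
  assumes "inj g"
  shows "mon N (g \<circ> c) = mon N' (g \<circ> c') \<longleftrightarrow> mon N c = mon N' c'"
proof
  have *: "Poly_Mapping.lookup (mon N (g \<circ> c)) (g v) = Poly_Mapping.lookup (mon N c) v" for N c v
    using assms by (simp add: lookup_mon inj_eq)
  assume "mon N (g \<circ> c) = mon N' (g \<circ> c')"
  then show "mon N c = mon N' c'"
    by (intro poly_mapping_eqI) (metis *)
next
  assume eq: "mon N c = mon N' c'"
  \<comment> \<open>The identity \<open>*\<close> says nothing about multiplicities outside the
    range of \<open>g\<close>. Instead, the new monomial is obtained by substitution and is
    therefore a function of the old one.\<close>
  have "Poly_Mapping.single (mon N (g \<circ> c)) (1::real) = monom_subst (\<lambda>v. mvar (g v)) (mon N c)" for N c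
    by (simp add: monom_subst_mon prod_mvar[of "g \<circ> c", unfolded comp_def] comp_def)
  then have "Poly_Mapping.single (mon N (g \<circ> c)) (1::real) = Poly_Mapping.single (mon N' (g \<circ> c')) 1"
    using eq by simp
  then show "mon N (g \<circ> c) = mon N' (g \<circ> c')"
    by (metis lookup_single_eq lookup_single_not_eq zero_neq_one)
qed

lemma perm_condition:
  fixes p :: "(bit ^ 'm::finite) mpoly"
  assumes p: "mat_act (perm_matrix g) p = p" and g: "bij g"
  shows "Poly_Mapping.lookup p (mon N (g \<circ> c)) = Poly_Mapping.lookup p (mon N c)"
proof -
  have "Poly_Mapping.lookup p t * Poly_Mapping.lookup (mat_act (perm_matrix g) (Poly_Mapping.single t 1)) (mon N (g \<circ> c))
      = (if t = mon N c then Poly_Mapping.lookup p t else 0)" for t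
  proof -
    obtain N' c' where "t = mon N' c'"
      by (rule mon_exhaust)
    then show ?thesis
      using mon_comp_eq_iff[OF bij_is_inj[OF g], of N' c' N c]
      by (simp add: mat_act_perm_matrix[OF g] lookup_single)
  qed
  then have "Poly_Mapping.lookup (mat_act (perm_matrix g) p) (mon N (g \<circ> c)) = Poly_Mapping.lookup p (mon N c)"
    by (subst lookup_mat_act) (simp add: in_keys_iff)
  then show ?thesis
    using p by simp
qed

text \<open>The constant contributes \<open>N\<close> copies of \<open>b\<close>; this is written as
  a multiple of the inner product of the all-ones word with itself, so that self-orthogonality
  annihilates every term.\<close>

lemma sum_quadratic_form:
  "(\<Sum>k<N. quadratic_form q (c k) + b)
    = (\<Sum>i\<in>UNIV. \<Sum>j\<in>{i..}. q i j * (\<Sum>k<N. code_row c i k * code_row c j k))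
      + b * (\<Sum>k<N. all_ones N k * all_ones N k)"
proof -
  have "(\<Sum>k<N. quadratic_form q (c k))
      = (\<Sum>i\<in>UNIV. \<Sum>k<N. \<Sum>j\<in>{i..}. q i j * (code_row c i k * code_row c j k))"
    unfolding quadratic_form_def code_row_def mult.assoc by (rule sum.swap)
  also have "\<dots> = (\<Sum>i\<in>UNIV. \<Sum>j\<in>{i..}. \<Sum>k<N. q i j * (code_row c i k * code_row c j k))"
    by (intro sum.cong refl sum.swap)
  finally have "(\<Sum>k<N. quadratic_form q (c k)) = \<dots>" .
  moreover have "(\<Sum>k<N. b) = b * (\<Sum>k<N. all_ones N k * all_ones N k)"
    unfolding sum_distrib_left by (intro sum.cong) (simp_all add: all_ones_def)
  ultimately show ?thesis
    by (simp only: sum.distrib sum_distrib_left)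
qed

lemma sum_quadratic_form_eq_0:
  assumes C: "(N, C) \<in> self_orthogonal_codes k" and c: "c \<in> tuples C"
  shows "(\<Sum>k<N. quadratic_form q (c k) + b) = 0"
proof -
  have "(\<Sum>k<N. code_row c i k * code_row c j k) = 0" "(\<Sum>k<N. all_ones N k * all_ones N k) = 0" for i j
    using self_orthogonal_codesD(3,5)[OF C] c unfolding tuples_def by blast+
  then show ?thesis
    unfolding sum_quadratic_form by (simp only: mult_zero_right sum.neutral_const add_0)
qed

lemma quadratic_form_single:
  assumes "i0 \<le> j0"
  shows "quadratic_form (\<lambda>i j. if i = i0 \<and> j = j0 then 1 else 0) v = v $ i0 * v $ j0"
proof -
  have "(\<Sum>j\<in>{i..}. (if i = i0 \<and> j = j0 then 1 else 0) * v $ i * v $ j)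
      = (if i = i0 then v $ i0 * v $ j0 else 0)" for i
  proof -
    have "(\<Sum>j\<in>{i..}. (if i = i0 \<and> j = j0 then 1 else 0) * v $ i * v $ j)
      = (\<Sum>j\<in>{i..}. if j = j0 then if i = i0 then v $ i * v $ j else 0 else 0)"
      by (intro sum.cong) auto
    also have "\<dots> = (if j0 \<in> {i..} then if i = i0 then v $ i * v $ j0 else 0 else 0)"
      by (subst sum.delta) (auto simp only: finite)
    finally show ?thesis
      using assms by auto
  qed
  then show ?thesis
    unfolding quadratic_form_def by (simp only: sum.delta finite UNIV_I if_True)
qed

text \<open>The forms \<open>v $ i * v $ j\<close> isolate the inner products of the rows, and the
  constant form 1 that of the all-ones word with itself. The case of equal indices gives the mixed
  products, since squaring is the identity on F_2.\<close>

lemma column_code_self_orthogonal: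
  fixes c :: "nat \<Rightarrow> bit ^ 'm::{finite,linorder}"
  assumes c: "c \<in> words N" and sum: "\<And>q b. (\<Sum>k<N. quadratic_form q (c k) + b) = 0"
  shows "(N, column_code N c) \<in> self_orthogonal_codes (CARD('m) + 1)"
proof -
  let ?G = "insert (all_ones N) (range (code_row c))"
  have quad: "(\<Sum>k<N. c k $ i * c k $ j) = 0" if "i \<le> j" for i j
    using sum[of "\<lambda>i' j'. if i' = i \<and> j' = j then 1 else 0" 0]
    unfolding quadratic_form_single[OF that] add_0_right .
  then have rows: "(\<Sum>k<N. c k $ i * c k $ j) = 0" for i j
    by (metis (no_types, lifting) linear mult.commute sum.cong)
  have "(\<Sum>k<N. 1::bit) = 0"
    using sum[of "\<lambda>i j. 0" 1]
    by (simp only: quadratic_form_def mult_zero_left sum.neutral_const add_0)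
  then have ones: "(\<Sum>k<N. all_ones N k * all_ones N k) = 0"
    by (simp add: all_ones_def)
  have mixed: "(\<Sum>k<N. all_ones N k * c k $ i) = 0" "(\<Sum>k<N. c k $ i * all_ones N k) = 0" for i
  proof -
    have "(\<Sum>k<N. all_ones N k * c k $ i) = (\<Sum>k<N. c k $ i * c k $ i)"
    proof (rule sum.cong[OF refl])
      fix k assume "k \<in> {..<N}"
      then show "all_ones N k * c k $ i = c k $ i * c k $ i"
        by (cases "c k $ i") (simp_all add: all_ones_def)
    qed
    then show 1: "(\<Sum>k<N. all_ones N k * c k $ i) = 0"
      unfolding rows .
    show "(\<Sum>k<N. c k $ i * all_ones N k) = 0"
      using 1 by (simp only: mult.commute)
  qed
  have "?G \<subseteq> column_code N c"
    unfolding column_code_def by (rule word.span_superset)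
  then have "?G \<subseteq> words N"
    using column_code_subset_words[OF c] by blast
  moreover have "(\<Sum>k<N. u k * w k) = 0" if "u \<in> ?G" "w \<in> ?G" for u w
    using that ones mixed rows unfolding code_row_def by blast
  ultimately have "?G \<subseteq> dual_code N ?G"
    unfolding dual_code_def by blast
  then have "self_orthogonal N (column_code N c)"
    unfolding column_code_def by (rule self_orthogonal_span)
  then show ?thesis
    unfolding self_orthogonal_codes_def linear_code_def
    using column_code_subset_words[OF c] dim_column_code_le[of N c] subspace_column_code[of N c]
      all_ones_in_column_code[of N c]
    by blast
qed

text \<open>Sign matrices fix each summand. Affine maps permute the summands, because they act on
  the finite set of tuples by an injection into itself.\<close>

lemma tuple_enumerator_invariant:
  assumes C: "(N, C) \<in> self_orthogonal_codes k"
  shows "(tuple_enumerator (N, C) :: (bit ^ 'm::{finite,linorder}) mpoly) \<in> parabolic_invariants"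
  unfolding parabolic_invariants_iff
proof (intro conjI allI ballI)
  fix q :: "'m \<Rightarrow> 'm \<Rightarrow> bit" and b
  show "mat_act (sign_matrix (\<lambda>v. quadratic_form q v + b)) (tuple_enumerator (N, C)) = tuple_enumerator (N, C)"
    unfolding tuple_enumerator_def prod.case mat_act_sum mat_act_sign_matrix
    by (intro sum.cong refl) (simp only: sum_quadratic_form_eq_0[OF C] simp_thms if_True scaleR_one)
next
  note C' = self_orthogonal_codesD[OF C]
  fix g :: "(bit, 'm) vec \<Rightarrow> (bit, 'm) vec" assume g: "g \<in> affine_general_linear"
  then have bij: "bij g"
    by (rule bij_affine_general_linear)
  have "inj_on (map_columns N g) (tuples C)"
    by (rule inj_on_subset[OF inj_on_map_columns[OF bij_is_inj[OF bij]] tuples_subset_words[OF C'(1)]])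
  moreover have "map_columns N g ` tuples C \<subseteq> tuples C"
    using map_columns_tuples[OF g C'(2,3,1)] by blast
  ultimately have "bij_betw (map_columns N g) (tuples C) (tuples C)"
    using endo_inj_surj[OF finite_tuples[OF C'(1)]] by (simp add: bij_betw_def)
  then have "(\<Sum>c\<in>tuples C. Poly_Mapping.single (mon N (map_columns N g c)) (1::real))
      = (\<Sum>c\<in>tuples C. Poly_Mapping.single (mon N c) 1)"
    by (rule sum.reindex_bij_betw)
  then show "mat_act (perm_matrix g) (tuple_enumerator (N, C)) = tuple_enumerator (N, C)"
    by (simp add: tuple_enumerator_def mat_act_sum mat_act_perm_matrix[OF bij] mon_map_columns)
qed

section \<open>Spanning, by way of the sums \<open>e D\<close> of the overview\<close>

definition generator_sum :: "nat \<Rightarrow> (nat \<Rightarrow> bit) set \<Rightarrow> (bit ^ 'm::finite) mpoly" where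
  "generator_sum N D = (\<Sum>c\<in>{c \<in> words N. column_code N c = D}. Poly_Mapping.single (mon N c) 1)"

text \<open>The index set consists of the subcodes that some tuple of \<open>C\<close> generates.
  For such a \<open>D\<close>, every matrix that generates \<open>D\<close> has its rows in
  \<open>C\<close>, so the fibre inside \<open>tuples C\<close> is the full index set of
  \<open>generator_sum\<close>.\<close>

lemma tuple_enumerator_eq_sum:
  assumes C: "(N, C) \<in> self_orthogonal_codes k"
  shows "tuple_enumerator (N, C)
    = (\<Sum>D\<in>column_code N ` (tuples C :: (nat \<Rightarrow> bit ^ 'm::finite) set). generator_sum N D :: (bit ^ 'm) mpoly)"
proof -
  note C' = self_orthogonal_codesD[OF C]
  have "{c \<in> tuples C. column_code N c = D} = {c :: nat \<Rightarrow> bit ^ 'm. c \<in> words N \<and> column_code N c = D}"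
    if "D \<in> column_code N ` (tuples C :: (nat \<Rightarrow> bit ^ 'm) set)" for D
  proof -
    have "D \<subseteq> C"
      using that column_code_subset[OF C'(2,3)] by blast
    then have "tuples D \<subseteq> (tuples C :: (nat \<Rightarrow> bit ^ 'm) set)"
      by (auto simp: tuples_def)
    then show ?thesis
      using subsetD[OF tuples_subset_words[OF C'(1)]] tuples_column_code by blast
  qed
  then show ?thesis
    unfolding tuple_enumerator_def generator_sum_def prod.case
    by (subst sum.image_gen[OF finite_tuples[OF C'(1)], of _ "column_code N"])
      (intro sum.cong refl, simp only:)
qed

text \<open>Inverts \<open>tuple_enumerator_eq_sum\<close>. A generating tuple of \<open>D\<close>
  makes \<open>D\<close> itself one of the summands; all others belong to proper subcodes, to which
  the induction applies.\<close>

lemma generator_sum_in_span: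
  fixes D :: "(nat \<Rightarrow> bit) set"
  assumes "(N, D) \<in> self_orthogonal_codes (CARD('m) + 1)"
  shows "(generator_sum N D :: (bit ^ 'm::finite) mpoly)
    \<in> span (tuple_enumerator ` self_orthogonal_codes (CARD('m) + 1))"
  using assms
proof (induction "card D" arbitrary: D rule: less_induct)
  case less
  note D' = self_orthogonal_codesD[OF less.prems]
  let ?I = "column_code N ` (tuples D :: (nat \<Rightarrow> bit ^ 'm) set)"
  have fin: "finite ?I"
    using finite_tuples[OF D'(1)] by blast
  have "D \<in> ?I"
    using exists_generating_tuple[OF less.prems] by blast
  then have "tuple_enumerator (N, D) = generator_sum N D + (\<Sum>D'\<in>?I - {D}. generator_sum N D' :: (bit ^ 'm) mpoly)"
    by (rule trans[OF tuple_enumerator_eq_sum[OF less.prems] sum.remove[OF fin]])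
  then have "(generator_sum N D :: (bit ^ 'm) mpoly) = tuple_enumerator (N, D) - (\<Sum>D'\<in>?I - {D}. generator_sum N D')"
    by simp
  moreover have "(generator_sum N E :: (bit ^ 'm) mpoly) \<in> span (tuple_enumerator ` self_orthogonal_codes (CARD('m) + 1))"
    if E: "E \<in> ?I - {D}" for E
  proof (rule less.hyps)
    show "(N, E) \<in> self_orthogonal_codes (CARD('m) + 1)"
      using E column_code_in_self_orthogonal_codes[OF less.prems] by blast
    have "E \<subset> D"
      using E column_code_subset[OF D'(2,3)] by blast
    then show "card E < card D"
      by (rule psubset_card_mono[OF finite_subset[OF D'(1) finite_words]])
  qed
  moreover have "(tuple_enumerator (N, D) :: (bit ^ 'm) mpoly) \<in> span (tuple_enumerator ` self_orthogonal_codes (CARD('m) + 1))"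
    using less.prems by (intro span_base imageI)
  ultimately show ?case
    by (simp only: span_diff span_sum)
qed

text \<open>An injection of the fibres. Using it for affine maps in both directions between two
  matrices shows that their monomials have equally many matrices.\<close>

lemma card_mon_fibre_le:
  fixes g :: "'v::{finite,zero} \<Rightarrow> 'v"
  assumes "inj g"
  shows "card {d \<in> words N. mon N d = mon N c} \<le> card {d \<in> words N. mon N d = mon N (g \<circ> c)}"
proof (rule card_inj_on_le)
  show "inj_on (map_columns N g) {d \<in> words N. mon N d = mon N c}"
    using inj_on_map_columns[OF assms] by (rule inj_on_subset) blast
  show "map_columns N g ` {d \<in> words N. mon N d = mon N c} \<subseteq> {d \<in> words N. mon N d = mon N (g \<circ> c)}"
    using mon_comp_eq_iff[OF assms] by (auto simp: map_columns_in_words mon_map_columns)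
  show "finite {d \<in> words N. mon N d = mon N (g \<circ> c)}"
    using finite_words by (rule finite_subset[rotated]) blast
qed

text \<open>Invariance under affine maps makes the weight \<open>h\<close> depend only on the
  generated code, and invariance under sign matrices makes it vanish unless that code is
  self-orthogonal. Collecting the matrices by code thus leaves multiples of
  \<open>generator_sum\<close>.\<close>

lemma invariant_in_span:
  fixes p :: "(bit ^ 'm::{finite,linorder}) mpoly"
  assumes p: "p \<in> parabolic_invariants"
  shows "p \<in> span (tuple_enumerator ` self_orthogonal_codes (CARD('m) + 1))"
proof -
  let ?S = "span (tuple_enumerator ` self_orthogonal_codes (CARD('m) + 1)) :: ((bit, 'm) vec) mpoly set"
  txt \<open>Dividing by the number of matrices with a given multiset of columns turns the sum over
    monomials into a sum over matrices.\<close>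
  define mult where "mult N c = card {d \<in> words N. mon N d = mon N c}" for N and c :: "nat \<Rightarrow> (bit, 'm) vec"
  define h where "h N c = Poly_Mapping.lookup p (mon N c) / mult N c" for N c
  \<comment> \<open>A degree bound that keeps the sum over lengths finite. For \<open>p = 0\<close>
    the maximum is taken over the empty set, but then any value serves, as all coefficients
    vanish.\<close>
  define n where "n = Max ((\<lambda>t. \<Sum>v\<in>UNIV. Poly_Mapping.lookup t v) ` Poly_Mapping.keys p)"
  have h_same: "h N c = h N c'" if same: "column_code N c = column_code N c'" "c \<in> words N" "c' \<in> words N"
    for N c c'
  proof -
    \<comment> \<open>Only an inequality between the fibre sizes; exchanging the two matrices gives
      equality.\<close>
    have half: "Poly_Mapping.lookup p (mon N c') = Poly_Mapping.lookup p (mon N c) \<and> mult N c \<le> mult N c'"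
      if hyps: "column_code N c = column_code N c'" "c \<in> words N" "c' \<in> words N" for c c'
    proof -
      obtain g where g: "g \<in> affine_general_linear" "\<And>k. k < N \<Longrightarrow> c' k = g (c k)"
        using affine_equivalent_if_same_code[OF hyps] by blast
      have bij: "bij g"
        by (rule bij_affine_general_linear[OF g(1)])
      have c': "mon N c' = mon N (g \<circ> c)"
        by (rule mon_cong) (simp add: g(2))
      have "mat_act (perm_matrix g) p = p"
        using p g(1) by (simp add: parabolic_invariants_iff)
      then show ?thesis
        unfolding c' mult_def using perm_condition[OF _ bij] card_mon_fibre_le[OF bij_is_inj[OF bij]] by blast
    qed
    show ?thesis
      using half[OF same] half[OF same(1)[symmetric] same(3,2)] by (simp add: h_def)
  qed
  have code: "(N, column_code N c) \<in> self_orthogonal_codes (CARD('m) + 1)" if "c \<in> words N" "h N c \<noteq> 0" for N c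
  proof (rule column_code_self_orthogonal[OF that(1)])
    fix q b
    show "(\<Sum>k<N. quadratic_form q (c k) + b) = 0"
      by (rule sign_condition[of "\<lambda>v. quadratic_form q v + b"])
        (use p that(2) in \<open>auto simp: parabolic_invariants_iff h_def\<close>)
  qed
  have expand: "p = (\<Sum>N\<le>n. \<Sum>c\<in>words N. h N c *\<^sub>R Poly_Mapping.single (mon N c) 1)" (is "_ = ?q")
  proof (rule poly_mapping_eqI)
    fix t :: "(bit, 'm) vec \<Rightarrow>\<^sub>0 nat"
    obtain M d where d: "d \<in> words M" "t = mon M d"
      by (rule mon_exhaust[of t])
    have inner: "(\<Sum>c\<in>words N. h N c * (if mon N c = t then 1 else 0)) = (if N = M then Poly_Mapping.lookup p t else 0)" for N
    proof (cases "N = M")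
      case True
      have "(\<Sum>c\<in>words N. h N c * (if mon N c = t then 1 else 0))
          = (\<Sum>c\<in>{c \<in> words M. mon M c = mon M d}. Poly_Mapping.lookup p t / mult M d)"
        unfolding True d(2)
        by (rule sum.mono_neutral_cong_right) (auto simp: h_def mult_def)
      also have "\<dots> = mult M d * (Poly_Mapping.lookup p t / mult M d)"
        by (simp add: mult_def)
      also have "\<dots> = Poly_Mapping.lookup p t"
      proof -
        have "finite {d' \<in> words M. mon M d' = mon M d}"
          by (rule finite_subset[OF _ finite_words[of M]]) blast
        then have "mult M d \<noteq> 0"
          using d(1) by (auto simp: mult_def card_eq_0_iff)
        then show ?thesis by simp
      qed
      finally show ?thesis using True by simp
    next
      case False
      then have "mon N c \<noteq> t" for c
        unfolding d(2) using mon_eq_length by blast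
      then show ?thesis using False by simp
    qed
    have "Poly_Mapping.lookup ?q t = (\<Sum>N\<le>n. if N = M then Poly_Mapping.lookup p t else 0)"
      by (simp add: lookup_sum lookup_single when_def inner)
    also have "\<dots> = (if M \<le> n then Poly_Mapping.lookup p t else 0)"
      by simp
    also have "\<dots> = Poly_Mapping.lookup p t"
    proof -
      have "M \<le> n" if "t \<in> Poly_Mapping.keys p"
      proof -
        have "M \<in> (\<lambda>t. \<Sum>v\<in>UNIV. Poly_Mapping.lookup t v) ` Poly_Mapping.keys p"
          using that by (rule rev_image_eqI) (simp add: d(2) sum_lookup_mon)
        then show ?thesis
          unfolding n_def by (intro Max_ge) auto
      qed
      then show ?thesis by (auto simp: in_keys_iff)
    qed
    finally show "Poly_Mapping.lookup p t = Poly_Mapping.lookup ?q t" ..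
  qed
  have part: "(\<Sum>c\<in>words N. h N c *\<^sub>R Poly_Mapping.single (mon N c) 1) \<in> ?S" for N
  proof -
    have "(\<Sum>c\<in>{c \<in> words N. column_code N c = D}. h N c *\<^sub>R Poly_Mapping.single (mon N c) 1) \<in> ?S" for D
    proof (cases "\<exists>c0\<in>words N. column_code N c0 = D \<and> h N c0 \<noteq> 0")
      case True
      then obtain c0 where c0: "c0 \<in> words N" "column_code N c0 = D" "h N c0 \<noteq> 0"
        by blast
      have "(\<Sum>c\<in>{c \<in> words N. column_code N c = D}. h N c *\<^sub>R Poly_Mapping.single (mon N c) (1::real))
          = h N c0 *\<^sub>R generator_sum N D"
        unfolding generator_sum_def scaleR_sum_right
        by (rule sum.cong) (use c0 h_same in auto)
      moreover have "(generator_sum N D :: ((bit, 'm) vec) mpoly) \<in> ?S"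
        using generator_sum_in_span code[OF c0(1,3)] c0(2) by blast
      ultimately show ?thesis
        by (simp add: span_scale)
    next
      case False
      then have "(\<Sum>c\<in>{c \<in> words N. column_code N c = D}. h N c *\<^sub>R Poly_Mapping.single (mon N c) (1::real)) = 0"
        by (intro sum.neutral) auto
      then show ?thesis
        by (simp only: span_zero)
    qed
    then show ?thesis
      by (subst sum.image_gen[OF finite_words, of _ _ "column_code N"]) (rule span_sum)
  qed
  have "?q \<in> ?S"
    by (rule span_sum[OF part])
  with expand show ?thesis
    by (rule ssubst[where P = "\<lambda>q. q \<in> ?S"])
qed

section \<open>Separation of equivalence classes and linear independence\<close>

lemma lookup_tuple_enumerator:
  assumes "C \<subseteq> words N"
  shows "Poly_Mapping.lookup (tuple_enumerator (N, C)) t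
    = card {c \<in> (tuples C :: (nat \<Rightarrow> bit ^ 'm::finite) set). mon N c = t}"
proof -
  have "Poly_Mapping.lookup (tuple_enumerator (N, C)) t
      = (\<Sum>c\<in>(tuples C :: (nat \<Rightarrow> bit ^ 'm) set). if mon N c = t then 1 else 0)"
    by (simp only: tuple_enumerator_def prod.case lookup_sum lookup_single when_def)
  also have "\<dots> = card {c \<in> (tuples C :: (nat \<Rightarrow> bit ^ 'm) set). mon N c = t}"
    by (simp only: sum.inter_filter[OF finite_tuples[OF assms], symmetric] sum_constant mult_1_right)
  finally show ?thesis .
qed

text \<open>A tuple of \<open>D\<close> with the same monomial is a column permutation of
  \<open>c\<close>, so the code it generates is a permuted copy of \<open>C\<close> inside
  \<open>D\<close>. If the cardinalities agree, this copy is all of \<open>D\<close>.\<close>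

lemma monomial_of_generating_tuple:
  fixes c :: "nat \<Rightarrow> bit ^ 'm::finite"
  assumes C: "(N, C) \<in> self_orthogonal_codes k" and c: "c \<in> tuples C" "column_code N c = C"
    and D: "(M, D) \<in> self_orthogonal_codes l"
    and t: "Poly_Mapping.lookup (tuple_enumerator (M, D)) (mon N c) \<noteq> 0"
  shows "card C \<le> card D" "card C = card D \<Longrightarrow> equivalent_codes (M, D) (N, C)"
proof -
  note C' = self_orthogonal_codesD[OF C] and D' = self_orthogonal_codesD[OF D]
  have "{d \<in> tuples D. mon M d = mon N c} \<noteq> {}"
    using t unfolding lookup_tuple_enumerator[OF D'(1)] by (metis card.empty of_nat_0)
  then obtain d where d: "d \<in> tuples D" "mon M d = mon N c"
    by blast
  have M: "M = N"
    by (rule mon_eq_length[OF d(2)])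
  obtain \<pi> where \<pi>: "\<pi> permutes {..<N}" "c = d \<circ> \<pi>"
    using mon_eq_imp_permutes[of N c d] d c(1) tuples_subset_words[OF C'(1)] tuples_subset_words[OF D'(1)]
    unfolding M by (metis subsetD)
  have C_eq: "C = (\<lambda>w. w \<circ> \<pi>) ` column_code N d"
    using column_code_comp_permutes[OF \<pi>(1), of d] c(2) \<pi>(2) by simp
  have sub: "column_code N d \<subseteq> D"
    using column_code_subset[OF D'(2,3) d(1)] M by simp
  have fin: "finite D"
    by (rule finite_subset[OF D'(1) finite_words])
  have card: "card C \<le> card (column_code N d)"
    unfolding C_eq by (rule card_image_le[OF finite_subset[OF sub fin]])
  with card_mono[OF fin sub] show "card C \<le> card D"
    by simp
  assume "card C = card D"
  with card card_mono[OF fin sub] have "column_code N d = D"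
    by (intro card_subset_eq[OF fin sub]) simp
  then show "equivalent_codes (M, D) (N, C)"
    using \<pi>(1) C_eq M by (auto simp: equivalent_codes_def)
qed

lemma lookup_generating_tuple:
  fixes c :: "nat \<Rightarrow> bit ^ 'm::finite"
  assumes "C \<subseteq> words N" "c \<in> tuples C"
  shows "Poly_Mapping.lookup (tuple_enumerator (N, C)) (mon N c) \<noteq> 0"
proof -
  have "finite {d \<in> (tuples C :: (nat \<Rightarrow> bit ^ 'm) set). mon N d = mon N c}"
    by (rule finite_subset[OF _ finite_tuples[OF assms(1)]]) blast
  then have "card {d \<in> tuples C. mon N d = mon N c} \<noteq> 0"
    using assms(2) by (auto simp: card_eq_0_iff)
  then show ?thesis
    unfolding lookup_tuple_enumerator[OF assms(1)] by simp
qed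

text \<open>Each code contains a permuted copy of the other, so the cardinalities agree and the copy
  is the whole code.\<close>

lemma tuple_enumerator_eq_imp_equivalent:
  assumes C: "C \<in> self_orthogonal_codes (CARD('m) + 1)" and D: "D \<in> self_orthogonal_codes (CARD('m) + 1)"
    and eq: "tuple_enumerator C = (tuple_enumerator D :: (bit ^ 'm::finite) mpoly)"
  shows "equivalent_codes C D"
proof -
  obtain N C' where C': "C = (N, C')" by (cases C)
  obtain M D' where D': "D = (M, D')" by (cases D)
  obtain c :: "nat \<Rightarrow> bit ^ 'm" where c: "c \<in> tuples C'" "column_code N c = C'"
    using exists_generating_tuple C unfolding C' by blast
  obtain d :: "nat \<Rightarrow> bit ^ 'm" where d: "d \<in> tuples D'" "column_code M d = D'"
    using exists_generating_tuple D unfolding D' by blast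
  have "Poly_Mapping.lookup (tuple_enumerator (M, D')) (mon N c) \<noteq> 0"
    using lookup_generating_tuple[OF self_orthogonal_codesD(1)[OF C[unfolded C']] c(1)] eq
    unfolding C' D' by simp
  note 1 = monomial_of_generating_tuple[OF C[unfolded C'] c D[unfolded D'] this]
  have "Poly_Mapping.lookup (tuple_enumerator (N, C')) (mon M d) \<noteq> 0"
    using lookup_generating_tuple[OF self_orthogonal_codesD(1)[OF D[unfolded D']] d(1)] eq
    unfolding C' D' by simp
  note 2 = monomial_of_generating_tuple[OF D[unfolded D'] d C[unfolded C'] this]
  show ?thesis
    using 1(1) 2 unfolding C' D' by simp
qed

text \<open>Among the codes with nonzero coefficient in a relation, take a largest one,
  \<open>C\<close>. The monomial of a generating tuple of \<open>C\<close> occurs in the enumerator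
  of another such code only if that code has the same size and is equivalent to \<open>C\<close>;
  hence it isolates the coefficient of \<open>C\<close>.\<close>

lemma independent_tuple_enumerators:
  "independent (tuple_enumerator ` self_orthogonal_codes (CARD('m) + 1) :: (bit ^ 'm::finite) mpoly set)"
proof
  let ?S = "self_orthogonal_codes (CARD('m) + 1)"
  assume "dependent (tuple_enumerator ` ?S :: (bit ^ 'm) mpoly set)"
  then obtain T u where T: "finite T" "T \<subseteq> (tuple_enumerator ` ?S :: (bit ^ 'm) mpoly set)"
    "(\<Sum>f\<in>T. u f *\<^sub>R f) = 0" "\<exists>f\<in>T. u f \<noteq> 0"
    unfolding dependent_explicit by blast
  \<comment> \<open>Injectivity on \<open>A\<close> keeps one code per enumerator, so no two
    distinct equivalent codes take part in the relation.\<close>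
  obtain A where A: "A \<subseteq> ?S" "T = tuple_enumerator ` A" "inj_on (tuple_enumerator :: _ \<Rightarrow> (bit ^ 'm) mpoly) A"
    using T(2) unfolding subset_image_inj by blast
  have fin: "finite A"
    using T(1) A(2,3) finite_imageD by blast
  define B where "B = {C \<in> A. u (tuple_enumerator C) \<noteq> 0}"
  have "finite B" "B \<noteq> {}"
    using A(2) fin T(4) by (auto simp: B_def)
  then have "Max ((\<lambda>C. card (snd C)) ` B) \<in> (\<lambda>C. card (snd C)) ` B"
    by (intro Max_in) auto
  then obtain C where C: "C \<in> B" "Max ((\<lambda>C. card (snd C)) ` B) = card (snd C)"
    by blast
  have max: "card (snd D) \<le> card (snd C)" if "D \<in> B" for D
    unfolding C(2)[symmetric] using \<open>finite B\<close> that by (intro Max_ge) auto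
  obtain N C' where C': "C = (N, C')" by (cases C)
  have CS: "(N, C') \<in> ?S"
    using C(1) A(1) C' by (auto simp: B_def)
  obtain c :: "nat \<Rightarrow> bit ^ 'm" where c: "c \<in> tuples C'" "column_code N c = C'"
    using exists_generating_tuple[OF CS] by blast
  have zero: "u (tuple_enumerator D) * Poly_Mapping.lookup (tuple_enumerator D) (mon N c) = 0"
    if D: "D \<in> A - {C}" for D
  proof (rule ccontr)
    obtain M D' where D': "D = (M, D')" by (cases D)
    assume *: "u (tuple_enumerator D) * Poly_Mapping.lookup (tuple_enumerator D) (mon N c) \<noteq> 0"
    then have DB: "D \<in> B"
      using D by (simp add: B_def)
    have DS: "(M, D') \<in> ?S"
      using D A(1) D' by blast
    have "Poly_Mapping.lookup (tuple_enumerator (M, D')) (mon N c) \<noteq> 0"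
      using * D' by simp
    note mono = monomial_of_generating_tuple[OF CS c DS this]
    have "card C' = card D'"
      using mono(1) max[OF DB] C' D' by simp
    then have "equivalent_codes D C"
      using mono(2) C' D' by simp
    then have "tuple_enumerator D = (tuple_enumerator C :: (bit ^ 'm) mpoly)"
      by (rule tuple_enumerator_equivalent)
    then show False
      using D C(1) A(3) by (auto simp: B_def inj_on_def)
  qed
  have "0 = (\<Sum>D\<in>A. u (tuple_enumerator D) * Poly_Mapping.lookup (tuple_enumerator D) (mon N c))"
    using arg_cong[OF T(3), of "\<lambda>p. Poly_Mapping.lookup p (mon N c)"]
    by (simp add: A(2) sum.reindex[OF A(3)] lookup_sum)
  also have "\<dots> = u (tuple_enumerator C) * Poly_Mapping.lookup (tuple_enumerator C) (mon N c)"
    using C(1) zero by (subst sum.remove[OF fin, of C]) (simp_all add: B_def sum.neutral)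
  finally show False
    using C(1) lookup_generating_tuple[OF self_orthogonal_codesD(1)[OF CS] c(1)] C' by (simp add: B_def)
qed

text \<open>Independence of a set of polynomials would not detect that two inequivalent codes have
  the same enumerator; the first conjunct excludes this and makes the basis indexed by equivalence
  classes.\<close>

theorem theorem4p6:
  fixes a :: "'m::{finite,linorder} \<Rightarrow> 'f::{field,finite}"
  assumes "CARD('f) = 2 ^ CARD('m)"
    and "bit_basis a"
  shows "(\<forall>C \<in> self_orthogonal_codes (CARD('m) + 1). \<forall>D \<in> self_orthogonal_codes (CARD('m) + 1).
            cwe_ext a C = cwe_ext a D \<longleftrightarrow> equivalent_codes C D)
    \<and> independent (cwe_ext a ` self_orthogonal_codes (CARD('m) + 1))
    \<and> span (cwe_ext a ` self_orthogonal_codes (CARD('m) + 1)) = parabolic_invariants"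
proof -
  have cwe: "cwe_ext a C = tuple_enumerator C" if "C \<in> self_orthogonal_codes (CARD('m) + 1)" for C
    using that cwe_ext_eq_tuple_enumerator[OF assms]
    by (cases C) (auto simp: self_orthogonal_codes_def)
  then have image: "cwe_ext a ` self_orthogonal_codes (CARD('m) + 1)
      = tuple_enumerator ` self_orthogonal_codes (CARD('m) + 1)"
    by simp
  have "mat_act g (0 :: ((bit, 'm) vec) mpoly) = 0" for g
    by (simp add: mat_act_def)
  then have subspace: "subspace (parabolic_invariants :: ((bit, 'm) vec) mpoly set)"
    by (simp add: parabolic_invariants_def subspace_def mat_act_add mat_act_scaleR)
  have span: "span (tuple_enumerator ` self_orthogonal_codes (CARD('m) + 1))
      = (parabolic_invariants :: ((bit, 'm) vec) mpoly set)"
  proof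
    show "span (tuple_enumerator ` self_orthogonal_codes (CARD('m) + 1))
        \<subseteq> (parabolic_invariants :: ((bit, 'm) vec) mpoly set)"
      by (rule span_minimal[OF _ subspace]) (auto intro: tuple_enumerator_invariant)
    show "(parabolic_invariants :: ((bit, 'm) vec) mpoly set)
        \<subseteq> span (tuple_enumerator ` self_orthogonal_codes (CARD('m) + 1))"
      using invariant_in_span by blast
  qed
  have "cwe_ext a C = cwe_ext a D \<longleftrightarrow> equivalent_codes C D"
    if "C \<in> self_orthogonal_codes (CARD('m) + 1)" "D \<in> self_orthogonal_codes (CARD('m) + 1)" for C D
    unfolding cwe[OF that(1)] cwe[OF that(2)]
    using tuple_enumerator_eq_imp_equivalent[OF that] tuple_enumerator_equivalent by blast
  then show ?thesis
    unfolding image using span independent_tuple_enumerators by blast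
qed

end
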